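(* Let $\mathcal T,\equiv$ be a theory in deduction modulo. If $\mathcal T,\equiv$ is super-consistent, then all proofs strongly normalize in $\mathcal T,\equiv$: every proof-term of natural deduction modulo $\equiv$ (with the axioms of $\mathcal T$ as hypotheses) is strongly normalizing for the proof-term reduction $\rhd$.
   Context: Deduction modulo: a theory $\mathcal T,\equiv$ consists of a set $\mathcal T$ of axioms in a (possibly many-sorted) first-order language together with a congruence $\equiv$ generated by a confluent rewrite system that rewrites terms to terms and atomic formulae to formulae. Proofs are those of intuitionistic natural deduction in which every rule is applied modulo $\equiv$ (e.g. from $\Gamma\vdash_\equiv C$ and $\Gamma\vdash_\equiv A$ one derives $\Gamma\vdash_\equiv B$ whenever $C\equiv A\Rightarrow B$; similarly for all other rules). Proofs are represented by proof-terms: proof variables $\alpha$, $\lambda\alpha\,\pi$, $(\pi\,\pi')$, $\langle\pi,\pi'\rangle$, $fst(\pi)$, $snd(\pi)$, $i(\pi)$, $j(\pi)$, $\delta(\pi,\alpha\pi',\beta\pi'')$, $\delta_\bot(\pi)$, $I$ (for $\top$), $\lambda x\,\pi$, $(\pi\,t)$, $\langle t,\pi\rangle$, $\delta_\exists(\pi,x\alpha\pi')$; proof-term reduction $\rhd$ is the contextual closure of the cut-reductions $(\lambda\alpha\,\pi)\pi'\rhd(\pi'/\alpha)\pi$, $fst\langle\pi_1,\pi_2\rangle\rhd\pi_1$, $snd\langle\pi_1,\pi_2\rangle\rhd\pi_2$, $\delta(i(\pi_1),\alpha\pi_2,\beta\pi_3)\rhd(\pi_1/\alpha)\pi_2$,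 $\delta(j(\pi_1),\alpha\pi_2,\beta\pi_3)\rhd(\pi_1/\beta)\pi_3$, $(\lambda x\,\pi)t\rhd(t/x)\pi$, $\delta_\exists(\langle t,\pi_1\rangle,x\alpha\pi_2)\rhd(\pi_1/\alpha)(t/x)\pi_2$. Truth values algebra: a structure $\langle \mathcal B,\mathcal B^+,\mathcal A,\mathcal E,\tilde\top,\tilde\bot,\tilde\Rightarrow,\tilde\wedge,\tilde\vee,\tilde\forall,\tilde\exists\rangle$ with $\mathcal B$ a set, $\mathcal B^+\subseteq\mathcal B$, $\mathcal A,\mathcal E\subseteq\wp(\mathcal B)$, $\tilde\top,\tilde\bot\in\mathcal B$, $\tilde\Rightarrow,\tilde\wedge,\tilde\vee:\mathcal B\times\mathcal B\to\mathcal B$, $\tilde\forall:\mathcal A\to\mathcal B$, $\tilde\exists:\mathcal E\to\mathcal B$, such that for all $a,b,c\in\mathcal B$, $A\in\mathcal A$, $E\in\mathcal E$ ($\tilde\Rightarrow$ associating to the right): (1) if $a\tilde\Rightarrow b\in\mathcal B^+$ and $a\in\mathcal B^+$ then $b\in\mathcal B^+$; (2) $a\tilde\Rightarrow b\tilde\Rightarrow a\in\mathcal B^+$; (3) $(a\tilde\Rightarrow b\tilde\Rightarrow c)\tilde\Rightarrow(a\tilde\Rightarrow b)\tilde\Rightarrow a\tilde\Rightarrow c\in\mathcal B^+$; (4) $\tilde\top\in\mathcal B^+$; (5) $\tilde\bot\tilde\Rightarrow a\in\mathcal B^+$; (6) $a\tilde\Rightarrow b\tilde\Rightarrow(a\tilde\wedge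 b)\in\mathcal B^+$; (7) $(a\tilde\wedge b)\tilde\Rightarrow a\in\mathcal B^+$; (8) $(a\tilde\wedge b)\tilde\Rightarrow b\in\mathcal B^+$; (9) $a\tilde\Rightarrow(a\tilde\vee b)\in\mathcal B^+$; (10) $b\tilde\Rightarrow(a\tilde\vee b)\in\mathcal B^+$; (11) $(a\tilde\vee b)\tilde\Rightarrow(a\tilde\Rightarrow c)\tilde\Rightarrow(b\tilde\Rightarrow c)\tilde\Rightarrow c\in\mathcal B^+$; (12) $a\tilde\Rightarrow A=\{a\tilde\Rightarrow e\mid e\in A\}\in\mathcal A$ and $E\tilde\Rightarrow a=\{e\tilde\Rightarrow a\mid e\in E\}\in\mathcal A$; (13) if $A\subseteq\mathcal B^+$ then $\tilde\forall A\in\mathcal B^+$; (14) $\tilde\forall(a\tilde\Rightarrow A)\tilde\Rightarrow a\tilde\Rightarrow\tilde\forall A\in\mathcal B^+$; (15) if $a\in A$ then $(\tilde\forall A)\tilde\Rightarrow a\in\mathcal B^+$; (16) if $a\in E$ then $a\tilde\Rightarrow\tilde\exists E\in\mathcal B^+$; (17) $(\tilde\exists E)\tilde\Rightarrow\tilde\forall(E\tilde\Rightarrow a)\tilde\Rightarrow a\in\mathcal B^+$. It is full if $\mathcal A=\mathcal E=\wp(\mathcal B)$. It is ordered if equipped with an order relation $\sqsubseteq$ on $\mathcal B$ such that $\mathcal B^+$ is upward closed, $\tilde\top$ is a maximal element, $\tilde\wedge,\tilde\vee$ are monotone, $\tilde\forall,\tilde\exists$ are monotone (for sets, $A\sqsubseteq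 A'$ iff every $x\in A$ has some $y\in A'$ with $x\sqsubseteq y$), and $\tilde\Rightarrow$ is anti-monotone in its left and monotone in its right argument. An ordered one is complete if every subset of $\mathcal B$ has a greatest lower bound for $\sqsubseteq$. Models: a $\mathcal B$-valued structure for the language consists of a domain $\mathcal M$ (one per sort), functions $\hat f:\mathcal M^n\to\mathcal M$ for function symbols and $\hat P:\mathcal M^n\to\mathcal B$ for predicate symbols. Denotations: $\llbracket x\rrbracket_\phi=\phi(x)$, $\llbracket f(t_1,\dots,t_n)\rrbracket_\phi=\hat f(\llbracket t_1\rrbracket_\phi,\dots)$, $\llbracket P(t_1,\dots,t_n)\rrbracket_\phi=\hat P(\dots)$, $\llbracket\top\rrbracket_\phi=\tilde\top$, $\llbracket\bot\rrbracket_\phi=\tilde\bot$, connectives interpreted by $\tilde\Rightarrow,\tilde\wedge,\tilde\vee$, $\llbracket\forall x\,A\rrbracket_\phi=\tilde\forall\{\llbracket A\rrbracket_{\phi+\langle x,e\rangle}\mid e\in\mathcal M\}$, $\llbracket\exists x\,A\rrbracket_\phi=\tilde\exists\{\llbracket A\rrbracket_{\phi+\langle x,e\rangle}\mid e\in\mathcal M\}$ (possibly undefined if the set is not in $\mathcal A$ resp. $\mathcal E$). A $\mathcal B$-valued structure is a model of $\mathcal T,\equiv$ if for every axiom $A$ of $\mathcal T$ and every assignment $\phi$, $\llbracket A\rrbracket_\phi$ is defined and in $\mathcal B^+$, and for all terms or formulae $A\equiv B$ and all $\phi$, $\llbracket A\rrbracket_\phi$ and $\llbracket B\rrbracket_\phi$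 are defined and equal. The theory $\mathcal T,\equiv$ is super-consistent if it has a $\mathcal B$-valued model for every full, ordered and complete truth values algebra $\mathcal B$.
   Formalization: In ordered algebras, monotonicity of ∀̃ is taken for the dual set order (every y∈A' has some x∈A with x⊑y); with the stated order used for ∀̃ too, the claim is false: some super-consistent theory has a non-normalizing proof. Domains of structures are non-empty. *)

theory Defs
  imports Main "HOL-Library.Confluence"
begin

section \<open>Many-sorted terms and formulae\<close>

text \<open>
  Every variable carries its sort: \<open>Var s n\<close> is the \<open>n\<close>-th variable of sort \<open>s\<close>.  Bound variables
  are de Bruijn indices, counted separately for each sort: a binder of sort \<open>s\<close> binds index \<open>0\<close> of
  sort \<open>s\<close> and leaves the variables of all other sorts untouched.  Terms of the datatypes below are
  thus formulae and proof-terms up to renaming of bound variables.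
\<close>

record ('f, 'p, 's) signature =
  fargs :: "'f \<Rightarrow> 's list"
  fres :: "'f \<Rightarrow> 's"
  pargs :: "'p \<Rightarrow> 's list"

datatype ('f, 's) tm = Var 's nat | Fn 'f "('f, 's) tm list"

datatype ('f, 'p, 's) fm =
    Atom 'p "('f, 's) tm list"
  | Top
  | Bot
  | Imp "('f, 'p, 's) fm" "('f, 'p, 's) fm"
  | And "('f, 'p, 's) fm" "('f, 'p, 's) fm"
  | Or "('f, 'p, 's) fm" "('f, 'p, 's) fm"
  | All 's "('f, 'p, 's) fm"
  | Ex 's "('f, 'p, 's) fm"

fun sort_of :: "('f, 'p, 's) signature \<Rightarrow> ('f, 's) tm \<Rightarrow> 's" where
  "sort_of \<Sigma> (Var s n) = s"
| "sort_of \<Sigma> (Fn f ts) = fres \<Sigma> f"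

fun wf_tm :: "('f, 'p, 's) signature \<Rightarrow> ('f, 's) tm \<Rightarrow> bool" where
  "wf_tm \<Sigma> (Var s n) \<longleftrightarrow> True"
| "wf_tm \<Sigma> (Fn f ts) \<longleftrightarrow> (\<forall>t \<in> set ts. wf_tm \<Sigma> t) \<and> map (sort_of \<Sigma>) ts = fargs \<Sigma> f"

fun wf_fm :: "('f, 'p, 's) signature \<Rightarrow> ('f, 'p, 's) fm \<Rightarrow> bool" where
  "wf_fm \<Sigma> (Atom P ts) \<longleftrightarrow> (\<forall>t \<in> set ts. wf_tm \<Sigma> t) \<and> map (sort_of \<Sigma>) ts = pargs \<Sigma> P"
| "wf_fm \<Sigma> Top \<longleftrightarrow> True"
| "wf_fm \<Sigma> Bot \<longleftrightarrow> True"
| "wf_fm \<Sigma> (Imp A B) \<longleftrightarrow> wf_fm \<Sigma> A \<and> wf_fm \<Sigma> B"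
| "wf_fm \<Sigma> (And A B) \<longleftrightarrow> wf_fm \<Sigma> A \<and> wf_fm \<Sigma> B"
| "wf_fm \<Sigma> (Or A B) \<longleftrightarrow> wf_fm \<Sigma> A \<and> wf_fm \<Sigma> B"
| "wf_fm \<Sigma> (All s A) \<longleftrightarrow> wf_fm \<Sigma> A"
| "wf_fm \<Sigma> (Ex s A) \<longleftrightarrow> wf_fm \<Sigma> A"

fun is_atom :: "('f, 'p, 's) fm \<Rightarrow> bool" where
  "is_atom (Atom P ts) \<longleftrightarrow> True"
| "is_atom _ \<longleftrightarrow> False"

subsection \<open>Capture-avoiding simultaneous substitution\<close>

type_synonym ('f, 's) tsub = "'s \<Rightarrow> nat \<Rightarrow> ('f, 's) tm"

fun tsubst :: "('f, 's) tsub \<Rightarrow> ('f, 's) tm \<Rightarrow> ('f, 's) tm" where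
  "tsubst \<sigma> (Var s n) = \<sigma> s n"
| "tsubst \<sigma> (Fn f ts) = Fn f (map (tsubst \<sigma>) ts)"

definition shift :: "'s \<Rightarrow> ('f, 's) tsub" where
  "shift s s' n = Var s' (if s' = s then Suc n else n)"

text \<open>The substitution \<open>up s \<sigma>\<close> is \<open>\<sigma>\<close> as it acts below a binder of sort \<open>s\<close>.\<close>

definition up :: "'s \<Rightarrow> ('f, 's) tsub \<Rightarrow> ('f, 's) tsub" where
  "up s \<sigma> s' n =
    (if s' = s then (case n of 0 \<Rightarrow> Var s 0 | Suc m \<Rightarrow> tsubst (shift s) (\<sigma> s m))
     else tsubst (shift s) (\<sigma> s' n))"

text \<open>\<open>inst s t\<close> is the substitution \<open>(t/x)\<close> for the variable \<open>x\<close> of an opened binder of sort \<open>s\<close>.\<close>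

definition inst :: "'s \<Rightarrow> ('f, 's) tm \<Rightarrow> ('f, 's) tsub" where
  "inst s t s' n =
    (if s' = s then (case n of 0 \<Rightarrow> t | Suc m \<Rightarrow> Var s m) else Var s' n)"

fun fsubst :: "('f, 's) tsub \<Rightarrow> ('f, 'p, 's) fm \<Rightarrow> ('f, 'p, 's) fm" where
  "fsubst \<sigma> (Atom P ts) = Atom P (map (tsubst \<sigma>) ts)"
| "fsubst \<sigma> Top = Top"
| "fsubst \<sigma> Bot = Bot"
| "fsubst \<sigma> (Imp A B) = Imp (fsubst \<sigma> A) (fsubst \<sigma> B)"
| "fsubst \<sigma> (And A B) = And (fsubst \<sigma> A) (fsubst \<sigma> B)"
| "fsubst \<sigma> (Or A B) = Or (fsubst \<sigma> A) (fsubst \<sigma> B)"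
| "fsubst \<sigma> (All s A) = All s (fsubst (up s \<sigma>) A)"
| "fsubst \<sigma> (Ex s A) = Ex s (fsubst (up s \<sigma>) A)"

definition wf_tsub :: "('f, 'p, 's) signature \<Rightarrow> ('f, 's) tsub \<Rightarrow> bool" where
  "wf_tsub \<Sigma> \<sigma> \<longleftrightarrow> (\<forall>s n. wf_tm \<Sigma> (\<sigma> s n) \<and> sort_of \<Sigma> (\<sigma> s n) = s)"


section \<open>Theories in deduction modulo\<close>

record ('f, 'p, 's) dm_theory =
  sig :: "('f, 'p, 's) signature"
  axs :: "('f, 'p, 's) fm set"
  trules :: "(('f, 's) tm \<times> ('f, 's) tm) set"
  frules :: "(('f, 'p, 's) fm \<times> ('f, 'p, 's) fm) set"

inductive trew :: "('f, 'p, 's) dm_theory \<Rightarrow> ('f, 's) tm \<Rightarrow> ('f, 's) tm \<Rightarrow> bool"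
  for T :: "('f, 'p, 's) dm_theory" where
  "(l, r) \<in> trules T \<Longrightarrow> wf_tsub (sig T) \<sigma> \<Longrightarrow> trew T (tsubst \<sigma> l) (tsubst \<sigma> r)"
| "trew T t t' \<Longrightarrow> trew T (Fn f (us @ t # vs)) (Fn f (us @ t' # vs))"

inductive frew :: "('f, 'p, 's) dm_theory \<Rightarrow> ('f, 'p, 's) fm \<Rightarrow> ('f, 'p, 's) fm \<Rightarrow> bool"
  for T :: "('f, 'p, 's) dm_theory" where
  "(L, R) \<in> frules T \<Longrightarrow> wf_tsub (sig T) \<sigma> \<Longrightarrow> frew T (fsubst \<sigma> L) (fsubst \<sigma> R)"
| "trew T t t' \<Longrightarrow> frew T (Atom P (us @ t # vs)) (Atom P (us @ t' # vs))"
| "frew T A A' \<Longrightarrow> frew T (Imp A B) (Imp A' B)"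
| "frew T B B' \<Longrightarrow> frew T (Imp A B) (Imp A B')"
| "frew T A A' \<Longrightarrow> frew T (And A B) (And A' B)"
| "frew T B B' \<Longrightarrow> frew T (And A B) (And A B')"
| "frew T A A' \<Longrightarrow> frew T (Or A B) (Or A' B)"
| "frew T B B' \<Longrightarrow> frew T (Or A B) (Or A B')"
| "frew T A A' \<Longrightarrow> frew T (All s A) (All s A')"
| "frew T A A' \<Longrightarrow> frew T (Ex s A) (Ex s A')"

definition wf_dm_theory :: "('f, 'p, 's) dm_theory \<Rightarrow> bool" where
  "wf_dm_theory T \<longleftrightarrow>
    (\<forall>A \<in> axs T. wf_fm (sig T) A) \<and>
    (\<forall>(l, r) \<in> trules T. wf_tm (sig T) l \<and> wf_tm (sig T) r \<and> sort_of (sig T) l = sort_of (sig T) r) \<and>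
    (\<forall>(L, R) \<in> frules T. is_atom L \<and> wf_fm (sig T) L \<and> wf_fm (sig T) R) \<and>
    confluentp (\<lambda>t u. wf_tm (sig T) t \<and> trew T t u) \<and>
    confluentp (\<lambda>A B. wf_fm (sig T) A \<and> frew T A B)"

text \<open>The congruence \<open>\<equiv>\<close>, on well-sorted terms and on well-sorted formulae.\<close>

definition tcong :: "('f, 'p, 's) dm_theory \<Rightarrow> ('f, 's) tm \<Rightarrow> ('f, 's) tm \<Rightarrow> bool" where
  "tcong T t u \<longleftrightarrow> wf_tm (sig T) t \<and> wf_tm (sig T) u \<and> equivclp (trew T) t u"

definition fcong :: "('f, 'p, 's) dm_theory \<Rightarrow> ('f, 'p, 's) fm \<Rightarrow> ('f, 'p, 's) fm \<Rightarrow> bool" where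
  "fcong T A B \<longleftrightarrow> wf_fm (sig T) A \<and> wf_fm (sig T) B \<and> equivclp (frew T) A B"


section \<open>Proof-terms and their reduction\<close>

text \<open>
  Proof variables are de Bruijn indices of their own.  \<open>Lam\<close> and each branch of \<open>Case\<close> bind one proof
  variable, \<open>TLam s\<close> binds one term variable of sort \<open>s\<close>, and \<open>Unpack s\<close>, which is \<open>\<delta>\<^sub>\<exists>(\<pi>, x \<alpha> \<pi>')\<close>,
  binds in its second argument both a term variable of sort \<open>s\<close> and a proof variable.
\<close>

datatype ('f, 's) pterm =
    PVar nat
  | Lam "('f, 's) pterm"
  | App "('f, 's) pterm" "('f, 's) pterm"
  | Pair "('f, 's) pterm" "('f, 's) pterm"
  | Fst "('f, 's) pterm"
  | Snd "('f, 's) pterm"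
  | InL "('f, 's) pterm"
  | InR "('f, 's) pterm"
  | Case "('f, 's) pterm" "('f, 's) pterm" "('f, 's) pterm"
  | Abort "('f, 's) pterm"
  | Triv
  | TLam 's "('f, 's) pterm"
  | TApp "('f, 's) pterm" "('f, 's) tm"
  | Pack "('f, 's) tm" "('f, 's) pterm"
  | Unpack 's "('f, 's) pterm" "('f, 's) pterm"

text \<open>Substitution of terms for term variables in a proof-term.\<close>

fun ptsubst :: "('f, 's) tsub \<Rightarrow> ('f, 's) pterm \<Rightarrow> ('f, 's) pterm" where
  "ptsubst \<sigma> (PVar n) = PVar n"
| "ptsubst \<sigma> (Lam p) = Lam (ptsubst \<sigma> p)"
| "ptsubst \<sigma> (App p q) = App (ptsubst \<sigma> p) (ptsubst \<sigma> q)"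
| "ptsubst \<sigma> (Pair p q) = Pair (ptsubst \<sigma> p) (ptsubst \<sigma> q)"
| "ptsubst \<sigma> (Fst p) = Fst (ptsubst \<sigma> p)"
| "ptsubst \<sigma> (Snd p) = Snd (ptsubst \<sigma> p)"
| "ptsubst \<sigma> (InL p) = InL (ptsubst \<sigma> p)"
| "ptsubst \<sigma> (InR p) = InR (ptsubst \<sigma> p)"
| "ptsubst \<sigma> (Case p q r) = Case (ptsubst \<sigma> p) (ptsubst \<sigma> q) (ptsubst \<sigma> r)"
| "ptsubst \<sigma> (Abort p) = Abort (ptsubst \<sigma> p)"
| "ptsubst \<sigma> Triv = Triv"
| "ptsubst \<sigma> (TLam s p) = TLam s (ptsubst (up s \<sigma>) p)"
| "ptsubst \<sigma> (TApp p t) = TApp (ptsubst \<sigma> p) (tsubst \<sigma> t)"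
| "ptsubst \<sigma> (Pack t p) = Pack (tsubst \<sigma> t) (ptsubst \<sigma> p)"
| "ptsubst \<sigma> (Unpack s p q) = Unpack s (ptsubst \<sigma> p) (ptsubst (up s \<sigma>) q)"

text \<open>Renaming of, then substitution for, proof variables.\<close>

definition upr :: "(nat \<Rightarrow> nat) \<Rightarrow> nat \<Rightarrow> nat" where
  "upr \<xi> n = (case n of 0 \<Rightarrow> 0 | Suc m \<Rightarrow> Suc (\<xi> m))"

fun pren :: "(nat \<Rightarrow> nat) \<Rightarrow> ('f, 's) pterm \<Rightarrow> ('f, 's) pterm" where
  "pren \<xi> (PVar n) = PVar (\<xi> n)"
| "pren \<xi> (Lam p) = Lam (pren (upr \<xi>) p)"
| "pren \<xi> (App p q) = App (pren \<xi> p) (pren \<xi> q)"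
| "pren \<xi> (Pair p q) = Pair (pren \<xi> p) (pren \<xi> q)"
| "pren \<xi> (Fst p) = Fst (pren \<xi> p)"
| "pren \<xi> (Snd p) = Snd (pren \<xi> p)"
| "pren \<xi> (InL p) = InL (pren \<xi> p)"
| "pren \<xi> (InR p) = InR (pren \<xi> p)"
| "pren \<xi> (Case p q r) = Case (pren \<xi> p) (pren (upr \<xi>) q) (pren (upr \<xi>) r)"
| "pren \<xi> (Abort p) = Abort (pren \<xi> p)"
| "pren \<xi> Triv = Triv"
| "pren \<xi> (TLam s p) = TLam s (pren \<xi> p)"
| "pren \<xi> (TApp p t) = TApp (pren \<xi> p) t"
| "pren \<xi> (Pack t p) = Pack t (pren \<xi> p)"
| "pren \<xi> (Unpack s p q) = Unpack s (pren \<xi> p) (pren (upr \<xi>) q)"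

definition upp :: "(nat \<Rightarrow> ('f, 's) pterm) \<Rightarrow> nat \<Rightarrow> ('f, 's) pterm" where
  "upp \<theta> n = (case n of 0 \<Rightarrow> PVar 0 | Suc m \<Rightarrow> pren Suc (\<theta> m))"

definition upt :: "'s \<Rightarrow> (nat \<Rightarrow> ('f, 's) pterm) \<Rightarrow> nat \<Rightarrow> ('f, 's) pterm" where
  "upt s \<theta> n = ptsubst (shift s) (\<theta> n)"

fun psubst :: "(nat \<Rightarrow> ('f, 's) pterm) \<Rightarrow> ('f, 's) pterm \<Rightarrow> ('f, 's) pterm" where
  "psubst \<theta> (PVar n) = \<theta> n"
| "psubst \<theta> (Lam p) = Lam (psubst (upp \<theta>) p)"
| "psubst \<theta> (App p q) = App (psubst \<theta> p) (psubst \<theta> q)"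
| "psubst \<theta> (Pair p q) = Pair (psubst \<theta> p) (psubst \<theta> q)"
| "psubst \<theta> (Fst p) = Fst (psubst \<theta> p)"
| "psubst \<theta> (Snd p) = Snd (psubst \<theta> p)"
| "psubst \<theta> (InL p) = InL (psubst \<theta> p)"
| "psubst \<theta> (InR p) = InR (psubst \<theta> p)"
| "psubst \<theta> (Case p q r) = Case (psubst \<theta> p) (psubst (upp \<theta>) q) (psubst (upp \<theta>) r)"
| "psubst \<theta> (Abort p) = Abort (psubst \<theta> p)"
| "psubst \<theta> Triv = Triv"
| "psubst \<theta> (TLam s p) = TLam s (psubst (upt s \<theta>) p)"
| "psubst \<theta> (TApp p t) = TApp (psubst \<theta> p) t"
| "psubst \<theta> (Pack t p) = Pack t (psubst \<theta> p)"
| "psubst \<theta> (Unpack s p q) = Unpack s (psubst \<theta> p) (psubst (upp (upt s \<theta>)) q)"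

text \<open>\<open>pinst q\<close> is the substitution \<open>(q/\<alpha>)\<close> for the proof variable \<open>\<alpha>\<close> of an opened binder.\<close>

definition pinst :: "('f, 's) pterm \<Rightarrow> nat \<Rightarrow> ('f, 's) pterm" where
  "pinst q n = (case n of 0 \<Rightarrow> q | Suc m \<Rightarrow> PVar m)"

inductive red :: "('f, 's) pterm \<Rightarrow> ('f, 's) pterm \<Rightarrow> bool" (infix "\<rhd>" 50) where
  "App (Lam p) q \<rhd> psubst (pinst q) p"
| "Fst (Pair p q) \<rhd> p"
| "Snd (Pair p q) \<rhd> q"
| "Case (InL p) q r \<rhd> psubst (pinst p) q"
| "Case (InR p) q r \<rhd> psubst (pinst p) r"
| "TApp (TLam s p) t \<rhd> ptsubst (inst s t) p"
| "Unpack s (Pack t p) q \<rhd> psubst (pinst p) (ptsubst (inst s t) q)"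
| "p \<rhd> p' \<Longrightarrow> Lam p \<rhd> Lam p'"
| "p \<rhd> p' \<Longrightarrow> App p q \<rhd> App p' q"
| "q \<rhd> q' \<Longrightarrow> App p q \<rhd> App p q'"
| "p \<rhd> p' \<Longrightarrow> Pair p q \<rhd> Pair p' q"
| "q \<rhd> q' \<Longrightarrow> Pair p q \<rhd> Pair p q'"
| "p \<rhd> p' \<Longrightarrow> Fst p \<rhd> Fst p'"
| "p \<rhd> p' \<Longrightarrow> Snd p \<rhd> Snd p'"
| "p \<rhd> p' \<Longrightarrow> InL p \<rhd> InL p'"
| "p \<rhd> p' \<Longrightarrow> InR p \<rhd> InR p'"
| "p \<rhd> p' \<Longrightarrow> Case p q r \<rhd> Case p' q r"
| "q \<rhd> q' \<Longrightarrow> Case p q r \<rhd> Case p q' r"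
| "r \<rhd> r' \<Longrightarrow> Case p q r \<rhd> Case p q r'"
| "p \<rhd> p' \<Longrightarrow> Abort p \<rhd> Abort p'"
| "p \<rhd> p' \<Longrightarrow> TLam s p \<rhd> TLam s p'"
| "p \<rhd> p' \<Longrightarrow> TApp p t \<rhd> TApp p' t"
| "p \<rhd> p' \<Longrightarrow> Pack t p \<rhd> Pack t p'"
| "p \<rhd> p' \<Longrightarrow> Unpack s p q \<rhd> Unpack s p' q"
| "q \<rhd> q' \<Longrightarrow> Unpack s p q \<rhd> Unpack s p q'"

definition strongly_normalizing :: "('f, 's) pterm \<Rightarrow> bool" where
  "strongly_normalizing p \<longleftrightarrow> termip (\<rhd>) p"


section \<open>Natural deduction modulo\<close>

text \<open>
  In \<open>nd T \<Gamma> p A\<close> the hypothesis of proof variable \<open>PVar i\<close> is \<open>\<Gamma> ! i\<close>.  The eigenvariable conditions of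
  \<open>AllI\<close> and \<open>ExE\<close> are expressed by shifting: a shifted formula does not contain index \<open>0\<close> of sort \<open>s\<close>.
\<close>

inductive nd :: "('f, 'p, 's) dm_theory \<Rightarrow> ('f, 'p, 's) fm list \<Rightarrow> ('f, 's) pterm \<Rightarrow>
    ('f, 'p, 's) fm \<Rightarrow> bool"
  for T :: "('f, 'p, 's) dm_theory" where
  Hyp: "i < length \<Gamma> \<Longrightarrow> fcong T (\<Gamma> ! i) A \<Longrightarrow> nd T \<Gamma> (PVar i) A"
| TopI: "fcong T A Top \<Longrightarrow> nd T \<Gamma> Triv A"
| BotE: "nd T \<Gamma> p B \<Longrightarrow> fcong T B Bot \<Longrightarrow> wf_fm (sig T) A \<Longrightarrow> nd T \<Gamma> (Abort p) A"
| ImpI: "nd T (A # \<Gamma>) p B \<Longrightarrow> fcong T C (Imp A B) \<Longrightarrow> nd T \<Gamma> (Lam p) C"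
| ImpE: "nd T \<Gamma> p C \<Longrightarrow> nd T \<Gamma> q A \<Longrightarrow> fcong T C (Imp A B) \<Longrightarrow> nd T \<Gamma> (App p q) B"
| AndI: "nd T \<Gamma> p A \<Longrightarrow> nd T \<Gamma> q B \<Longrightarrow> fcong T C (And A B) \<Longrightarrow> nd T \<Gamma> (Pair p q) C"
| AndE1: "nd T \<Gamma> p C \<Longrightarrow> fcong T C (And A B) \<Longrightarrow> nd T \<Gamma> (Fst p) A"
| AndE2: "nd T \<Gamma> p C \<Longrightarrow> fcong T C (And A B) \<Longrightarrow> nd T \<Gamma> (Snd p) B"
| OrI1: "nd T \<Gamma> p A \<Longrightarrow> fcong T C (Or A B) \<Longrightarrow> nd T \<Gamma> (InL p) C"
| OrI2: "nd T \<Gamma> p B \<Longrightarrow> fcong T C (Or A B) \<Longrightarrow> nd T \<Gamma> (InR p) C"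
| OrE: "nd T \<Gamma> p D \<Longrightarrow> nd T (A # \<Gamma>) q C \<Longrightarrow> nd T (B # \<Gamma>) r C \<Longrightarrow> fcong T D (Or A B) \<Longrightarrow>
    nd T \<Gamma> (Case p q r) C"
| AllI: "nd T (map (fsubst (shift s)) \<Gamma>) p A \<Longrightarrow> fcong T C (All s A) \<Longrightarrow> nd T \<Gamma> (TLam s p) C"
| AllE: "nd T \<Gamma> p D \<Longrightarrow> fcong T D (All s A) \<Longrightarrow> wf_tm (sig T) t \<Longrightarrow> sort_of (sig T) t = s \<Longrightarrow>
    fcong T C (fsubst (inst s t) A) \<Longrightarrow> nd T \<Gamma> (TApp p t) C"
| ExI: "nd T \<Gamma> p D \<Longrightarrow> wf_tm (sig T) t \<Longrightarrow> sort_of (sig T) t = s \<Longrightarrow>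
    fcong T D (fsubst (inst s t) A) \<Longrightarrow> fcong T C (Ex s A) \<Longrightarrow> nd T \<Gamma> (Pack t p) C"
| ExE: "nd T \<Gamma> p D \<Longrightarrow> fcong T D (Ex s A) \<Longrightarrow>
    nd T (A # map (fsubst (shift s)) \<Gamma>) q (fsubst (shift s) B) \<Longrightarrow> wf_fm (sig T) B \<Longrightarrow>
    nd T \<Gamma> (Unpack s p q) B"

definition is_proof :: "('f, 'p, 's) dm_theory \<Rightarrow> ('f, 's) pterm \<Rightarrow> ('f, 'p, 's) fm \<Rightarrow> bool" where
  "is_proof T p A \<longleftrightarrow> (\<exists>\<Gamma>. set \<Gamma> \<subseteq> axs T \<and> nd T \<Gamma> p A)"


section \<open>Truth values algebras\<close>

record 'b tv_algebra =
  carr :: "'b set"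
  pos :: "'b set"
  univs :: "'b set set"
  exs :: "'b set set"
  tv_top :: "'b" ("\<top>\<index>")
  tv_bot :: "'b" ("\<bottom>\<index>")
  tv_imp :: "'b \<Rightarrow> 'b \<Rightarrow> 'b" (infixr "\<leadsto>\<index>" 60)
  tv_and :: "'b \<Rightarrow> 'b \<Rightarrow> 'b" (infixr "\<sqinter>\<index>" 75)
  tv_or :: "'b \<Rightarrow> 'b \<Rightarrow> 'b" (infixr "\<squnion>\<index>" 70)
  tv_all :: "'b set \<Rightarrow> 'b" ("\<Sqinter>\<index>")
  tv_ex :: "'b set \<Rightarrow> 'b" ("\<Squnion>\<index>")

locale truth_values_algebra =
  fixes B :: "('b, 'x) tv_algebra_scheme" (structure)
  assumes pos_subset: "pos B \<subseteq> carr B"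
    and univs_subset: "univs B \<subseteq> Pow (carr B)"
    and exs_subset: "exs B \<subseteq> Pow (carr B)"
    and top_closed: "\<top> \<in> carr B"
    and bot_closed: "\<bottom> \<in> carr B"
    and imp_closed: "\<lbrakk>a \<in> carr B; b \<in> carr B\<rbrakk> \<Longrightarrow> a \<leadsto> b \<in> carr B"
    and and_closed: "\<lbrakk>a \<in> carr B; b \<in> carr B\<rbrakk> \<Longrightarrow> a \<sqinter> b \<in> carr B"
    and or_closed: "\<lbrakk>a \<in> carr B; b \<in> carr B\<rbrakk> \<Longrightarrow> a \<squnion> b \<in> carr B"
    and all_closed: "A \<in> univs B \<Longrightarrow> \<Sqinter> A \<in> carr B"
    and ex_closed: "E \<in> exs B \<Longrightarrow> \<Squnion> E \<in> carr B"
    and mp: "\<lbrakk>a \<in> carr B; b \<in> carr B; a \<leadsto> b \<in> pos B; a \<in> pos B\<rbrakk> \<Longrightarrow> b \<in> pos B"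
    and ax_K: "\<lbrakk>a \<in> carr B; b \<in> carr B\<rbrakk> \<Longrightarrow> a \<leadsto> b \<leadsto> a \<in> pos B"
    and ax_S: "\<lbrakk>a \<in> carr B; b \<in> carr B; c \<in> carr B\<rbrakk> \<Longrightarrow>
      (a \<leadsto> b \<leadsto> c) \<leadsto> (a \<leadsto> b) \<leadsto> a \<leadsto> c \<in> pos B"
    and ax_top: "\<top> \<in> pos B"
    and ax_bot: "a \<in> carr B \<Longrightarrow> \<bottom> \<leadsto> a \<in> pos B"
    and ax_andI: "\<lbrakk>a \<in> carr B; b \<in> carr B\<rbrakk> \<Longrightarrow> a \<leadsto> b \<leadsto> (a \<sqinter> b) \<in> pos B"
    and ax_andE1: "\<lbrakk>a \<in> carr B; b \<in> carr B\<rbrakk> \<Longrightarrow> (a \<sqinter> b) \<leadsto> a \<in> pos B"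
    and ax_andE2: "\<lbrakk>a \<in> carr B; b \<in> carr B\<rbrakk> \<Longrightarrow> (a \<sqinter> b) \<leadsto> b \<in> pos B"
    and ax_orI1: "\<lbrakk>a \<in> carr B; b \<in> carr B\<rbrakk> \<Longrightarrow> a \<leadsto> (a \<squnion> b) \<in> pos B"
    and ax_orI2: "\<lbrakk>a \<in> carr B; b \<in> carr B\<rbrakk> \<Longrightarrow> b \<leadsto> (a \<squnion> b) \<in> pos B"
    and ax_orE: "\<lbrakk>a \<in> carr B; b \<in> carr B; c \<in> carr B\<rbrakk> \<Longrightarrow>
      (a \<squnion> b) \<leadsto> (a \<leadsto> c) \<leadsto> (b \<leadsto> c) \<leadsto> c \<in> pos B"
    and imp_univs: "\<lbrakk>a \<in> carr B; A \<in> univs B\<rbrakk> \<Longrightarrow> (\<lambda>e. a \<leadsto> e) ` A \<in> univs B"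
    and exs_imp: "\<lbrakk>a \<in> carr B; E \<in> exs B\<rbrakk> \<Longrightarrow> (\<lambda>e. e \<leadsto> a) ` E \<in> univs B"
    and ax_gen: "\<lbrakk>A \<in> univs B; A \<subseteq> pos B\<rbrakk> \<Longrightarrow> \<Sqinter> A \<in> pos B"
    and ax_allI: "\<lbrakk>a \<in> carr B; A \<in> univs B\<rbrakk> \<Longrightarrow>
      \<Sqinter> ((\<lambda>e. a \<leadsto> e) ` A) \<leadsto> a \<leadsto> \<Sqinter> A \<in> pos B"
    and ax_allE: "\<lbrakk>A \<in> univs B; a \<in> A\<rbrakk> \<Longrightarrow> \<Sqinter> A \<leadsto> a \<in> pos B"
    and ax_exI: "\<lbrakk>E \<in> exs B; a \<in> E\<rbrakk> \<Longrightarrow> a \<leadsto> \<Squnion> E \<in> pos B"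
    and ax_exE: "\<lbrakk>a \<in> carr B; E \<in> exs B\<rbrakk> \<Longrightarrow>
      \<Squnion> E \<leadsto> \<Sqinter> ((\<lambda>e. e \<leadsto> a) ` E) \<leadsto> a \<in> pos B"

definition full_tva :: "('b, 'x) tv_algebra_scheme \<Rightarrow> bool" where
  "full_tva B \<longleftrightarrow> univs B = Pow (carr B) \<and> exs B = Pow (carr B)"

record 'b ordered_tv_algebra = "'b tv_algebra" +
  tv_le :: "'b \<Rightarrow> 'b \<Rightarrow> bool" (infix "\<sqsubseteq>\<index>" 50)

text \<open>
  Monotonicity of the quantifiers needs an order on sets of truth values.  For \<open>\<exists>\<close> it is
  "every \<open>x \<in> E\<close> is below some \<open>y \<in> E'\<close>"; for \<open>\<forall>\<close> it has to be the dual one,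
  "every \<open>y \<in> A'\<close> is above some \<open>x \<in> A\<close>".  With the former order for \<open>\<forall>\<close> as well, one would
  have \<open>\<forall>\<emptyset> \<sqsubseteq> \<forall>A\<close> for all \<open>A\<close>, hence every truth value of a full ordered algebra would be positive
  (lemma \<open>lower_monotone_all_trivial\<close> below).  This excludes all non-trivial complete Heyting algebras
  as well as the algebra of reducibility candidates, and super-consistency would no longer imply
  normalization: the rules \<open>C \<longlonglongrightarrow> (\<exists>x. (\<forall>k. Z(k,x) \<Rightarrow> Z(k,1)) \<and> P(x)) \<Rightarrow> \<bottom>\<close>, \<open>P(1) \<longlonglongrightarrow> C\<close>,
  \<open>Z(k\<^sub>0,x) \<longlonglongrightarrow> P(x)\<close> would have models in all full, ordered and complete algebras.
\<close>

locale ordered_truth_values_algebra =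
  truth_values_algebra B for B :: "('b, 'x) ordered_tv_algebra_scheme" (structure) +
  assumes le_refl: "a \<in> carr B \<Longrightarrow> a \<sqsubseteq> a"
    and le_trans: "\<lbrakk>a \<in> carr B; b \<in> carr B; c \<in> carr B; a \<sqsubseteq> b; b \<sqsubseteq> c\<rbrakk> \<Longrightarrow> a \<sqsubseteq> c"
    and le_antisym: "\<lbrakk>a \<in> carr B; b \<in> carr B; a \<sqsubseteq> b; b \<sqsubseteq> a\<rbrakk> \<Longrightarrow> a = b"
    and pos_upward: "\<lbrakk>a \<in> pos B; b \<in> carr B; a \<sqsubseteq> b\<rbrakk> \<Longrightarrow> b \<in> pos B"
    and top_maximal: "\<lbrakk>a \<in> carr B; \<top> \<sqsubseteq> a\<rbrakk> \<Longrightarrow> a = \<top>"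
    and and_mono: "\<lbrakk>a \<in> carr B; a' \<in> carr B; b \<in> carr B; b' \<in> carr B; a \<sqsubseteq> a'; b \<sqsubseteq> b'\<rbrakk> \<Longrightarrow>
      a \<sqinter> b \<sqsubseteq> a' \<sqinter> b'"
    and or_mono: "\<lbrakk>a \<in> carr B; a' \<in> carr B; b \<in> carr B; b' \<in> carr B; a \<sqsubseteq> a'; b \<sqsubseteq> b'\<rbrakk> \<Longrightarrow>
      a \<squnion> b \<sqsubseteq> a' \<squnion> b'"
    and imp_mono: "\<lbrakk>a \<in> carr B; a' \<in> carr B; b \<in> carr B; b' \<in> carr B; a' \<sqsubseteq> a; b \<sqsubseteq> b'\<rbrakk> \<Longrightarrow>
      a \<leadsto> b \<sqsubseteq> a' \<leadsto> b'"
    and all_mono: "\<lbrakk>A \<in> univs B; A' \<in> univs B; \<forall>y \<in> A'. \<exists>x \<in> A. x \<sqsubseteq> y\<rbrakk> \<Longrightarrow> \<Sqinter> A \<sqsubseteq> \<Sqinter> A'"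
    and ex_mono: "\<lbrakk>E \<in> exs B; E' \<in> exs B; \<forall>x \<in> E. \<exists>y \<in> E'. x \<sqsubseteq> y\<rbrakk> \<Longrightarrow> \<Squnion> E \<sqsubseteq> \<Squnion> E'"

lemma (in ordered_truth_values_algebra) lower_monotone_all_trivial:
  assumes "full_tva B"
    and mono: "\<And>A A'. \<lbrakk>A \<in> univs B; A' \<in> univs B; \<forall>x \<in> A. \<exists>y \<in> A'. x \<sqsubseteq> y\<rbrakk> \<Longrightarrow> \<Sqinter> A \<sqsubseteq> \<Sqinter> A'"
  shows "pos B = carr B"
proof
  show "carr B \<subseteq> pos B"
  proof
    fix a assume a: "a \<in> carr B"
    have univs: "{} \<in> univs B" "{a} \<in> univs B"
      using assms(1) a by (auto simp: full_tva_def)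
    have "\<Sqinter> {} \<in> pos B"
      using univs(1) ax_gen by blast
    then have "\<Sqinter> {a} \<in> pos B"
      using mono[OF univs] pos_upward all_closed[OF univs(2)] by blast
    then show "a \<in> pos B"
      using mp[OF all_closed[OF univs(2)] a ax_allE[OF univs(2)]] by blast
  qed
qed (rule pos_subset)

definition complete_tva :: "('b, 'x) ordered_tv_algebra_scheme \<Rightarrow> bool" where
  "complete_tva B \<longleftrightarrow> (\<forall>S \<subseteq> carr B. \<exists>g \<in> carr B.
    (\<forall>x \<in> S. tv_le B g x) \<and> (\<forall>h \<in> carr B. (\<forall>x \<in> S. tv_le B h x) \<longrightarrow> tv_le B h g))"


section \<open>Models and super-consistency\<close>

record ('f, 'p, 's, 'm, 'b) struct =
  dom :: "'s \<Rightarrow> 'm set"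
  fint :: "'f \<Rightarrow> 'm list \<Rightarrow> 'm"
  pint :: "'p \<Rightarrow> 'm list \<Rightarrow> 'b"

definition is_structure ::
  "('b, 'x) tv_algebra_scheme \<Rightarrow> ('f, 'p, 's) signature \<Rightarrow> ('f, 'p, 's, 'm, 'b) struct \<Rightarrow> bool" where
  "is_structure B \<Sigma> M \<longleftrightarrow>
    (\<forall>s. dom M s \<noteq> {}) \<and>
    (\<forall>f. \<forall>xs \<in> listset (map (dom M) (fargs \<Sigma> f)). fint M f xs \<in> dom M (fres \<Sigma> f)) \<and>
    (\<forall>P. \<forall>xs \<in> listset (map (dom M) (pargs \<Sigma> P)). pint M P xs \<in> carr B)"

definition is_assignment :: "('f, 'p, 's, 'm, 'b) struct \<Rightarrow> ('s \<Rightarrow> nat \<Rightarrow> 'm) \<Rightarrow> bool" where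
  "is_assignment M \<phi> \<longleftrightarrow> (\<forall>s n. \<phi> s n \<in> dom M s)"

text \<open>The assignment \<open>\<phi> + \<langle>x, e\<rangle>\<close>, where \<open>x\<close> is the variable bound by a binder of sort \<open>s\<close>.\<close>

definition extend :: "'s \<Rightarrow> 'm \<Rightarrow> ('s \<Rightarrow> nat \<Rightarrow> 'm) \<Rightarrow> 's \<Rightarrow> nat \<Rightarrow> 'm" where
  "extend s e \<phi> s' n = (if s' = s then (case n of 0 \<Rightarrow> e | Suc m \<Rightarrow> \<phi> s m) else \<phi> s' n)"

fun tden :: "('f, 'p, 's, 'm, 'b) struct \<Rightarrow> ('s \<Rightarrow> nat \<Rightarrow> 'm) \<Rightarrow> ('f, 's) tm \<Rightarrow> 'm" where
  "tden M \<phi> (Var s n) = \<phi> s n"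
| "tden M \<phi> (Fn f ts) = fint M f (map (tden M \<phi>) ts)"

text \<open>The denotation of a formula is \<open>fden\<close>; it is meaningful only where \<open>fdefined\<close> holds.\<close>

fun fden :: "('b, 'x) tv_algebra_scheme \<Rightarrow> ('f, 'p, 's, 'm, 'b) struct \<Rightarrow> ('s \<Rightarrow> nat \<Rightarrow> 'm) \<Rightarrow>
    ('f, 'p, 's) fm \<Rightarrow> 'b" where
  "fden B M \<phi> (Atom P ts) = pint M P (map (tden M \<phi>) ts)"
| "fden B M \<phi> Top = tv_top B"
| "fden B M \<phi> Bot = tv_bot B"
| "fden B M \<phi> (Imp C D) = tv_imp B (fden B M \<phi> C) (fden B M \<phi> D)"
| "fden B M \<phi> (And C D) = tv_and B (fden B M \<phi> C) (fden B M \<phi> D)"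
| "fden B M \<phi> (Or C D) = tv_or B (fden B M \<phi> C) (fden B M \<phi> D)"
| "fden B M \<phi> (All s C) = tv_all B ((\<lambda>e. fden B M (extend s e \<phi>) C) ` dom M s)"
| "fden B M \<phi> (Ex s C) = tv_ex B ((\<lambda>e. fden B M (extend s e \<phi>) C) ` dom M s)"

fun fdefined :: "('b, 'x) tv_algebra_scheme \<Rightarrow> ('f, 'p, 's, 'm, 'b) struct \<Rightarrow> ('s \<Rightarrow> nat \<Rightarrow> 'm) \<Rightarrow>
    ('f, 'p, 's) fm \<Rightarrow> bool" where
  "fdefined B M \<phi> (Atom P ts) \<longleftrightarrow> True"
| "fdefined B M \<phi> Top \<longleftrightarrow> True"
| "fdefined B M \<phi> Bot \<longleftrightarrow> True"
| "fdefined B M \<phi> (Imp C D) \<longleftrightarrow> fdefined B M \<phi> C \<and> fdefined B M \<phi> D"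
| "fdefined B M \<phi> (And C D) \<longleftrightarrow> fdefined B M \<phi> C \<and> fdefined B M \<phi> D"
| "fdefined B M \<phi> (Or C D) \<longleftrightarrow> fdefined B M \<phi> C \<and> fdefined B M \<phi> D"
| "fdefined B M \<phi> (All s C) \<longleftrightarrow> (\<forall>e \<in> dom M s. fdefined B M (extend s e \<phi>) C) \<and>
    (\<lambda>e. fden B M (extend s e \<phi>) C) ` dom M s \<in> univs B"
| "fdefined B M \<phi> (Ex s C) \<longleftrightarrow> (\<forall>e \<in> dom M s. fdefined B M (extend s e \<phi>) C) \<and>
    (\<lambda>e. fden B M (extend s e \<phi>) C) ` dom M s \<in> exs B"

definition is_model ::
  "('b, 'x) tv_algebra_scheme \<Rightarrow> ('f, 'p, 's) dm_theory \<Rightarrow> ('f, 'p, 's, 'm, 'b) struct \<Rightarrow> bool" where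
  "is_model B T M \<longleftrightarrow> is_structure B (sig T) M \<and> (\<forall>\<phi>. is_assignment M \<phi> \<longrightarrow>
    (\<forall>A \<in> axs T. fdefined B M \<phi> A \<and> fden B M \<phi> A \<in> pos B) \<and>
    (\<forall>t u. tcong T t u \<longrightarrow> tden M \<phi> t = tden M \<phi> u) \<and>
    (\<forall>A C. fcong T A C \<longrightarrow>
      fdefined B M \<phi> A \<and> fdefined B M \<phi> C \<and> fden B M \<phi> A = fden B M \<phi> C))"

text \<open>
  HOL cannot quantify over all types inside a formula, so the type \<open>'b\<close> that contains the carriers of
  the algebras and the type \<open>'m\<close> that contains the domains of the models are parameters of
  super-consistency.  Enlarging \<open>'b\<close> strengthens the property, enlarging \<open>'m\<close> weakens it.  A theorem
  that assumes super-consistency at \<open>'b = ('f, 's) pterm set\<close>, where the sets of proof-terms live, and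
  at an arbitrary type \<open>'m\<close> therefore covers every larger universe of truth values too.
\<close>

definition super_consistent :: "'b itself \<Rightarrow> 'm itself \<Rightarrow> ('f, 'p, 's) dm_theory \<Rightarrow> bool" where
  "super_consistent _ _ T \<longleftrightarrow>
    (\<forall>B :: 'b ordered_tv_algebra.
      ordered_truth_values_algebra B \<and> full_tva B \<and> complete_tva B \<longrightarrow>
      (\<exists>M :: ('f, 'p, 's, 'm, 'b) struct. is_model B T M))"

end

theory Submission
  imports Defs
begin

text \<open>
  Reducibility candidates, ordered by inclusion and all of them positive, form a full, ordered and
  complete truth values algebra, so super-consistency provides a model valued in candidates.  In that
  model the denotation of a formula is a set of strongly normalizing proof-terms that contains all
  proof variables, and Tait's argument shows that every proof of \<open>A\<close> belongs to the denotation of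
  \<open>A\<close>.  Conversion modulo \<open>\<equiv>\<close> is harmless because congruent formulae denote the same candidate.
  Proof-terms are treated as untyped: the terms substituted for term variables in a proof are
  unrelated to the elements of the model assigned to these variables.
\<close>

section \<open>Substitution calculus\<close>

lemma tsubst_tsubst: "tsubst \<tau> (tsubst \<sigma> t) = tsubst (\<lambda>s n. tsubst \<tau> (\<sigma> s n)) t"
  by (induction t) auto

lemma tsubst_Var [simp]: "tsubst Var t = t"
  by (induction t) (auto simp: map_idI)

lemma up_Var [simp]: "up s Var = Var"
  by (intro ext) (auto simp: up_def shift_def split: nat.split)

lemma up_shift: "(\<lambda>s' n. tsubst (up s \<sigma>) (shift s s' n)) = (\<lambda>s' n. tsubst (shift s) (\<sigma> s' n))"
  by (intro ext) (simp add: shift_def up_def)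

text \<open>Functoriality of \<open>up\<close>, needed wherever a composition passes a term binder.
  Stating it between functions lets the simplifier rewrite the substitution itself inside
  \<open>ptsubst\<close>.\<close>

lemma tsubst_up_up: "(\<lambda>s' n. tsubst (up s \<tau>) (up s \<sigma> s' n)) = up s (\<lambda>s' n. tsubst \<tau> (\<sigma> s' n))"
proof -
  have "tsubst (up s \<tau>) (tsubst (shift s) t) = tsubst (shift s) (tsubst \<tau> t)" for t
    by (simp add: tsubst_tsubst up_shift)
  then show ?thesis
    by (intro ext) (simp add: up_def[of _ \<sigma>] up_def[of _ "\<lambda>s' n. tsubst \<tau> (\<sigma> s' n)"] split: nat.split,
      simp add: up_def)
qed

lemma ptsubst_ptsubst: "ptsubst \<tau> (ptsubst \<sigma> p) = ptsubst (\<lambda>s n. tsubst \<tau> (\<sigma> s n)) p"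
  by (induction p arbitrary: \<sigma> \<tau>) (simp_all add: tsubst_tsubst tsubst_up_up)

lemma ptsubst_Var [simp]: "ptsubst Var p = p"
  by (induction p) simp_all

lemma ptsubst_up_shift:
  "ptsubst (up s \<sigma>) (ptsubst (shift s) p) = ptsubst (shift s) (ptsubst \<sigma> p)"
  by (simp add: ptsubst_ptsubst up_shift)

lemma tsubst_inst_shift: "(\<lambda>s' n. tsubst (inst s t) (shift s s' n)) = Var"
  by (intro ext) (simp add: shift_def inst_def)

lemma ptsubst_inst_shift [simp]: "ptsubst (inst s t) (ptsubst (shift s) p) = p"
  by (simp add: ptsubst_ptsubst tsubst_inst_shift)

lemma tsubst_inst: "(\<lambda>s' n. tsubst \<sigma> (inst s t s' n)) =
    (\<lambda>s' n. tsubst (inst s (tsubst \<sigma> t)) (up s \<sigma> s' n))"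
  by (intro ext) (auto simp: inst_def up_def tsubst_tsubst tsubst_inst_shift split: nat.split)

lemma ptsubst_inst: "ptsubst \<sigma> (ptsubst (inst s t) p) =
    ptsubst (inst s (tsubst \<sigma> t)) (ptsubst (up s \<sigma>) p)"
  by (simp add: ptsubst_ptsubst tsubst_inst)

section \<open>Renaming and substitution of proof variables\<close>

lemma upr_comp: "upr \<xi> \<circ> upr \<zeta> = upr (\<xi> \<circ> \<zeta>)"
  by (intro ext) (simp add: upr_def split: nat.split)

lemma pren_pren: "pren \<xi> (pren \<zeta> p) = pren (\<xi> \<circ> \<zeta>) p"
  by (induction p arbitrary: \<xi> \<zeta>) (simp_all add: upr_comp)

lemma pren_upr_Suc: "pren (upr \<xi>) (pren Suc p) = pren Suc (pren \<xi> p)"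
proof -
  have "upr \<xi> \<circ> Suc = Suc \<circ> \<xi>"
    by (intro ext) (simp add: upr_def)
  then show ?thesis
    by (simp add: pren_pren)
qed

lemma ptsubst_pren: "ptsubst \<sigma> (pren \<xi> p) = pren \<xi> (ptsubst \<sigma> p)"
  by (induction p arbitrary: \<sigma> \<xi>) simp_all

lemma ptsubst_upp: "(\<lambda>n. ptsubst \<sigma> (upp \<theta> n)) = upp (\<lambda>n. ptsubst \<sigma> (\<theta> n))"
  by (intro ext) (simp add: upp_def ptsubst_pren split: nat.split)

lemma ptsubst_upt: "(\<lambda>n. ptsubst (up s \<sigma>) (upt s \<theta> n)) = upt s (\<lambda>n. ptsubst \<sigma> (\<theta> n))"
  by (intro ext) (simp add: upt_def ptsubst_up_shift)

lemma ptsubst_psubst: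
  "ptsubst \<sigma> (psubst \<theta> p) = psubst (\<lambda>n. ptsubst \<sigma> (\<theta> n)) (ptsubst \<sigma> p)"
  by (induction p arbitrary: \<sigma> \<theta>) (simp_all add: ptsubst_upp ptsubst_upt)

lemma upp_upr: "upp \<theta> \<circ> upr \<xi> = upp (\<theta> \<circ> \<xi>)"
  by (intro ext) (simp add: upp_def upr_def split: nat.split)

lemma upt_comp: "upt s \<theta> \<circ> \<xi> = upt s (\<theta> \<circ> \<xi>)"
  by (intro ext) (simp add: upt_def)

lemma psubst_pren: "psubst \<theta> (pren \<xi> p) = psubst (\<theta> \<circ> \<xi>) p"
  by (induction p arbitrary: \<theta> \<xi>) (simp_all add: upp_upr upt_comp)

lemma pren_upp: "(\<lambda>n. pren (upr \<xi>) (upp \<theta> n)) = upp (\<lambda>n. pren \<xi> (\<theta> n))"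
  by (intro ext) (simp add: upp_def pren_upr_Suc split: nat.split, simp add: upr_def)

lemma pren_upt: "(\<lambda>n. pren \<xi> (upt s \<theta> n)) = upt s (\<lambda>n. pren \<xi> (\<theta> n))"
  by (intro ext) (simp add: upt_def ptsubst_pren)

lemma pren_psubst: "pren \<xi> (psubst \<theta> p) = psubst (\<lambda>n. pren \<xi> (\<theta> n)) p"
  by (induction p arbitrary: \<theta> \<xi>) (simp_all add: pren_upp pren_upt)

lemma psubst_upp_Suc: "psubst (upp \<tau>) (pren Suc p) = pren Suc (psubst \<tau> p)"
proof -
  have "upp \<tau> \<circ> Suc = (\<lambda>n. pren Suc (\<tau> n))"
    by (intro ext) (simp add: upp_def)
  then show ?thesis
    by (simp add: psubst_pren pren_psubst)
qed

lemma psubst_upp: "(\<lambda>n. psubst (upp \<tau>) (upp \<theta> n)) = upp (\<lambda>n. psubst \<tau> (\<theta> n))"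
proof
  fix n show "psubst (upp \<tau>) (upp \<theta> n) = upp (\<lambda>n. psubst \<tau> (\<theta> n)) n"
  proof (cases n)
    case 0 then show ?thesis by (simp add: upp_def)
  next
    case (Suc m)
    then have "upp \<theta> n = pren Suc (\<theta> m)" "upp (\<lambda>n. psubst \<tau> (\<theta> n)) n = pren Suc (psubst \<tau> (\<theta> m))"
      by (simp_all add: upp_def)
    then show ?thesis by (simp only: psubst_upp_Suc)
  qed
qed

lemma psubst_upt: "(\<lambda>n. psubst (upt s \<tau>) (upt s \<theta> n)) = upt s (\<lambda>n. psubst \<tau> (\<theta> n))"
  by (intro ext) (simp add: upt_def[abs_def] ptsubst_psubst)

text \<open>Below binders the images of \<open>\<theta>\<close> are weakened by
  \<open>pren Suc\<close> or \<open>ptsubst (shift s)\<close>, so the mixed laws come first: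
  \<open>psubst_upp\<close> rests on \<open>psubst_pren\<close> and \<open>pren_psubst\<close>,
  \<open>psubst_upt\<close> on \<open>ptsubst_psubst\<close>.\<close>

lemma psubst_psubst: "psubst \<tau> (psubst \<theta> p) = psubst (\<lambda>n. psubst \<tau> (\<theta> n)) p"
  by (induction p arbitrary: \<theta> \<tau>) (simp_all add: psubst_upp psubst_upt)

lemma upp_PVar [simp]: "upp PVar = PVar"
  by (intro ext) (simp add: upp_def split: nat.split)

lemma upt_PVar [simp]: "upt s PVar = PVar"
  by (intro ext) (simp add: upt_def)

lemma psubst_PVar [simp]: "psubst PVar p = p"
  by (induction p) simp_all

lemma psubst_pinst_Suc [simp]: "psubst (pinst q) (pren Suc p) = p"
proof -
  have "pinst q \<circ> Suc = PVar"
    by (intro ext) (simp add: pinst_def)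
  then show ?thesis
    by (simp add: psubst_pren)
qed

text \<open>Opening a binder after substituting below it is one substitution with an extended
  environment. In this shape the induction hypotheses of the adequacy proof apply to the body of a
  binder.\<close>

lemma psubst_pinst_upp: "psubst (pinst q) (psubst (upp \<theta>) p) = psubst (case_nat q \<theta>) p"
proof -
  have "(\<lambda>n. psubst (pinst q) (upp \<theta> n)) = case_nat q \<theta>"
    by (intro ext) (simp add: upp_def split: nat.split, simp add: pinst_def)
  then show ?thesis
    by (simp add: psubst_psubst)
qed

lemma psubst_pinst: "psubst \<theta> (psubst (pinst q) p) = psubst (pinst (psubst \<theta> q)) (psubst (upp \<theta>) p)"
proof -
  have "(\<lambda>n. psubst \<theta> (pinst q n)) = case_nat (psubst \<theta> q) \<theta>"
    by (intro ext) (simp add: pinst_def split: nat.split)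
  then show ?thesis
    by (simp add: psubst_pinst_upp psubst_psubst[of \<theta>])
qed

lemma ptsubst_pinst: "ptsubst \<sigma> (psubst (pinst q) p) = psubst (pinst (ptsubst \<sigma> q)) (ptsubst \<sigma> p)"
proof -
  have "(\<lambda>n. ptsubst \<sigma> (pinst q n)) = pinst (ptsubst \<sigma> q)"
    by (intro ext) (simp add: pinst_def split: nat.split)
  then show ?thesis
    by (simp add: ptsubst_psubst)
qed

text \<open>\<open>upt\<close> shifts the images of \<open>\<theta>\<close>, and instantiating the
  fresh index undoes exactly that shift.\<close>

lemma ptsubst_inst_upt: "ptsubst (inst s t) (psubst (upt s \<theta>) p) = psubst \<theta> (ptsubst (inst s t) p)"
  by (simp add: ptsubst_psubst upt_def)

lemma ptsubst_inst_upp_upt: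
  "ptsubst (inst s t) (psubst (upp (upt s \<theta>)) p) = psubst (upp \<theta>) (ptsubst (inst s t) p)"
  by (simp add: ptsubst_psubst ptsubst_upp) (simp add: upt_def)

section \<open>Reduction and strong normalization\<close>

text \<open>The reduct is a variable constrained by an equation, so that the rule applies even when
  the expected reduct matches only after commuting two substitutions.\<close>

lemma red_TApp_TLam: "q = ptsubst (inst s t) p \<Longrightarrow> TApp (TLam s p) t \<rhd> q"
  by (simp add: red.intros)

lemma red_Unpack_Pack: "r = psubst (pinst p) (ptsubst (inst s t) q) \<Longrightarrow> Unpack s (Pack t p) q \<rhd> r"
  by (simp add: red.intros)

lemma red_psubst: "p \<rhd> p' \<Longrightarrow> psubst \<theta> p \<rhd> psubst \<theta> p'"
proof (induction arbitrary: \<theta> rule: red.induct)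
qed (auto simp: psubst_pinst ptsubst_inst_upt ptsubst_inst_upp_upt
  intro: red.intros red_TApp_TLam red_Unpack_Pack)

lemma red_ptsubst: "p \<rhd> p' \<Longrightarrow> ptsubst \<sigma> p \<rhd> ptsubst \<sigma> p'"
proof (induction arbitrary: \<sigma> rule: red.induct)
qed (auto simp: ptsubst_pinst ptsubst_inst intro: red.intros)

inductive_cases red_PVarE: "PVar n \<rhd> q"
inductive_cases red_LamE: "Lam p \<rhd> q"
inductive_cases red_AppE [consumes 1, case_names beta head arg]: "App p p' \<rhd> q"
inductive_cases red_PairE: "Pair p p' \<rhd> q"
inductive_cases red_FstE [consumes 1, case_names beta arg]: "Fst p \<rhd> q"
inductive_cases red_SndE [consumes 1, case_names beta arg]: "Snd p \<rhd> q"
inductive_cases red_InLE: "InL p \<rhd> q"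
inductive_cases red_InRE: "InR p \<rhd> q"
inductive_cases red_CaseE [consumes 1, case_names inl inr arg left right]: "Case p p' p'' \<rhd> q"
inductive_cases red_AbortE: "Abort p \<rhd> q"
inductive_cases red_TrivE: "Triv \<rhd> q"
inductive_cases red_TLamE: "TLam s p \<rhd> q"
inductive_cases red_TAppE [consumes 1, case_names beta head]: "TApp p t \<rhd> q"
inductive_cases red_PackE: "Pack t p \<rhd> q"
inductive_cases red_UnpackE [consumes 1, case_names beta arg branch]: "Unpack s p p' \<rhd> q"

section \<open>Induction principles for strong normalization\<close>

abbreviation SN :: "('f, 's) pterm \<Rightarrow> bool" where
  "SN \<equiv> strongly_normalizing"

lemma SN_I: "(\<And>p'. p \<rhd> p' \<Longrightarrow> SN p') \<Longrightarrow> SN p"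
  unfolding strongly_normalizing_def by (rule accp.intros) auto

lemma SN_red: "SN p \<Longrightarrow> p \<rhd> p' \<Longrightarrow> SN p'"
  unfolding strongly_normalizing_def by (erule accp_downward) simp

lemma SN_induct [consumes 1]:
  assumes "SN p" and "\<And>p. SN p \<Longrightarrow> (\<And>p'. p \<rhd> p' \<Longrightarrow> P p') \<Longrightarrow> P p"
  shows "P p"
proof (rule accp_induct[OF assms(1)[unfolded strongly_normalizing_def]])
qed (rule assms(2), simp_all add: strongly_normalizing_def)

text \<open>Nested inductions: the outer one on \<open>p\<close> keeps \<open>q\<close> general, the
  inner one on \<open>q\<close> fixes \<open>p\<close>. A step may thus occur in either
  component.\<close>

lemma SN_induct2 [consumes 2]:
  assumes "SN p" "SN q"
    and step: "\<And>p q. SN p \<Longrightarrow> SN q \<Longrightarrow> (\<And>p'. p \<rhd> p' \<Longrightarrow> P p' q) \<Longrightarrow> (\<And>q'. q \<rhd> q' \<Longrightarrow> P p q') \<Longrightarrow> P p q"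
  shows "P p q"
  using assms(1,2)
proof (induction p arbitrary: q rule: SN_induct)
  case p: (1 p)
  from p(3) show ?case
    by (induction q rule: SN_induct) (rule step, use p in auto)
qed

lemma SN_induct3 [consumes 3]:
  assumes "SN p" "SN q" "SN r"
    and step: "\<And>p q r. SN p \<Longrightarrow> SN q \<Longrightarrow> SN r \<Longrightarrow> (\<And>p'. p \<rhd> p' \<Longrightarrow> P p' q r) \<Longrightarrow>
      (\<And>q'. q \<rhd> q' \<Longrightarrow> P p q' r) \<Longrightarrow> (\<And>r'. r \<rhd> r' \<Longrightarrow> P p q r') \<Longrightarrow> P p q r"
  shows "P p q r"
  using assms(1,2,3)
proof (induction p arbitrary: q r rule: SN_induct)
  case p: (1 p)
  from p(3,4) show ?case
    by (induction q r rule: SN_induct2) (rule step, use p in auto)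
qed

text \<open>An infinite reduction from \<open>p\<close> would be carried by \<open>f\<close> to one
  from \<open>f p\<close>.\<close>

lemma SN_preimage:
  assumes "SN (f p)" and "\<And>p p'. p \<rhd> p' \<Longrightarrow> f p \<rhd> f p'"
  shows "SN p"
  using assms(1)
proof (induction "f p" arbitrary: p rule: SN_induct)
  case 1
  show ?case by (rule SN_I) (use 1 assms(2) in blast)
qed

lemma SN_psubstD: "SN (psubst \<theta> p) \<Longrightarrow> SN p"
  by (rule SN_preimage[of "psubst \<theta>"]) (auto intro: red_psubst)

lemma SN_ptsubstD: "SN (ptsubst \<sigma> p) \<Longrightarrow> SN p"
  by (rule SN_preimage[of "ptsubst \<sigma>"]) (auto intro: red_ptsubst)

section \<open>Reducibility candidates\<close>

text \<open>Neutral means not an introduction: placed in the principal position of an elimination,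
  such a proof-term creates no cut.\<close>

fun neutral :: "('f, 's) pterm \<Rightarrow> bool" where
  "neutral (Lam p) \<longleftrightarrow> False"
| "neutral (Pair p q) \<longleftrightarrow> False"
| "neutral (InL p) \<longleftrightarrow> False"
| "neutral (InR p) \<longleftrightarrow> False"
| "neutral Triv \<longleftrightarrow> False"
| "neutral (TLam s p) \<longleftrightarrow> False"
| "neutral (Pack t p) \<longleftrightarrow> False"
| "neutral _ \<longleftrightarrow> True"

text \<open>Girard's three conditions CR1, CR2 and CR3.\<close>

definition candidate :: "('f, 's) pterm set \<Rightarrow> bool" where
  "candidate a \<longleftrightarrow> (\<forall>p \<in> a. SN p) \<and> (\<forall>p \<in> a. \<forall>p'. p \<rhd> p' \<longrightarrow> p' \<in> a) \<and>
    (\<forall>p. neutral p \<longrightarrow> (\<forall>p'. p \<rhd> p' \<longrightarrow> p' \<in> a) \<longrightarrow> p \<in> a)"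

lemma candidate_SN: "candidate a \<Longrightarrow> p \<in> a \<Longrightarrow> SN p"
  unfolding candidate_def by blast

lemma candidate_red: "candidate a \<Longrightarrow> p \<in> a \<Longrightarrow> p \<rhd> p' \<Longrightarrow> p' \<in> a"
  unfolding candidate_def by blast

lemma candidate_neutral: "candidate a \<Longrightarrow> neutral p \<Longrightarrow> (\<And>p'. p \<rhd> p' \<Longrightarrow> p' \<in> a) \<Longrightarrow> p \<in> a"
  unfolding candidate_def by blast

text \<open>A variable is neutral and has no reducts, so the third condition holds vacuously. In
  particular every candidate is inhabited.\<close>

lemma candidate_PVar: "candidate a \<Longrightarrow> PVar n \<in> a"
  by (erule candidate_neutral) (auto elim: red_PVarE)

text \<open>
  A condition \<open>V\<close> on reducts that is void for neutral proof-terms always yields a candidate.  All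
  connectives are given in this form, by conditions on introductions only, so they produce candidates
  whatever sets they are applied to.
\<close>

definition val_cand :: "(('f, 's) pterm \<Rightarrow> bool) \<Rightarrow> ('f, 's) pterm set" where
  "val_cand V = {p. SN p \<and> (\<forall>v. (\<rhd>)\<^sup>*\<^sup>* p v \<longrightarrow> V v)}"

text \<open>A reduction from \<open>p\<close> is either empty or passes through a one-step reduct,
  which gives the form suited to induction on reducts.\<close>

lemma val_cand_I:
  assumes "V p" "\<And>p'. p \<rhd> p' \<Longrightarrow> p' \<in> val_cand V"
  shows "p \<in> val_cand V"
proof -
  have "SN p"
    by (rule SN_I) (use assms(2) in \<open>simp add: val_cand_def\<close>)
  moreover have "V v" if "(\<rhd>)\<^sup>*\<^sup>* p v" for v
    using that
  proof (cases rule: converse_rtranclpE)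
    case base
    then show ?thesis using assms(1) by simp
  next
    case (step p')
    then show ?thesis using assms(2)[of p'] by (simp add: val_cand_def)
  qed
  ultimately show ?thesis
    by (simp add: val_cand_def)
qed

lemma val_cand_D: "p \<in> val_cand V \<Longrightarrow> V p"
  by (simp add: val_cand_def)

lemma val_cand_SN: "p \<in> val_cand V \<Longrightarrow> SN p"
  by (simp add: val_cand_def)

lemma val_cand_red: "p \<in> val_cand V \<Longrightarrow> p \<rhd> p' \<Longrightarrow> p' \<in> val_cand V"
  by (auto simp: val_cand_def dest: SN_red intro: converse_rtranclp_into_rtranclp[of "(\<rhd>)"])

lemma val_cand_mono: "(\<And>v. V v \<Longrightarrow> W v) \<Longrightarrow> val_cand V \<subseteq> val_cand W"
  by (auto simp: val_cand_def)

lemma candidate_val_cand: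
  assumes "\<And>v. neutral v \<Longrightarrow> V v"
  shows "candidate (val_cand V)"
proof -
  have "p \<in> val_cand V" if "neutral p" "\<forall>p'. p \<rhd> p' \<longrightarrow> p' \<in> val_cand V" for p
    by (rule val_cand_I) (use assms that in auto)
  then show ?thesis
    unfolding candidate_def using val_cand_SN val_cand_red by blast
qed

section \<open>The connectives on candidates\<close>

definition top_cand :: "('f, 's) pterm set" where
  "top_cand = val_cand (\<lambda>v. True)"

definition imp_cand :: "('f, 's) pterm set \<Rightarrow> ('f, 's) pterm set \<Rightarrow> ('f, 's) pterm set" where
  "imp_cand a b = val_cand (\<lambda>v. \<forall>p. v = Lam p \<longrightarrow> (\<forall>q \<in> a. psubst (pinst q) p \<in> b))"

definition and_cand :: "('f, 's) pterm set \<Rightarrow> ('f, 's) pterm set \<Rightarrow> ('f, 's) pterm set" where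
  "and_cand a b = val_cand (\<lambda>v. \<forall>p q. v = Pair p q \<longrightarrow> p \<in> a \<and> q \<in> b)"

definition or_cand :: "('f, 's) pterm set \<Rightarrow> ('f, 's) pterm set \<Rightarrow> ('f, 's) pterm set" where
  "or_cand a b = val_cand (\<lambda>v. \<forall>p. (v = InL p \<longrightarrow> p \<in> a) \<and> (v = InR p \<longrightarrow> p \<in> b))"

text \<open>The term \<open>t\<close> and the candidate \<open>a\<close> vary independently: an
  algebra sees only the set of values of a quantified formula, not which individual produced which
  value. \<open>ex_cand\<close> likewise leaves its witness unrelated to the candidate.\<close>

definition all_cand :: "('f, 's) pterm set set \<Rightarrow> ('f, 's) pterm set" where
  "all_cand A = val_cand (\<lambda>v. \<forall>s p. v = TLam s p \<longrightarrow> (\<forall>t. \<forall>a \<in> A. ptsubst (inst s t) p \<in> a))"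

definition ex_cand :: "('f, 's) pterm set set \<Rightarrow> ('f, 's) pterm set" where
  "ex_cand E = val_cand (\<lambda>v. \<forall>t p. v = Pack t p \<longrightarrow> (\<exists>a \<in> E. p \<in> a))"

lemmas cand_defs = top_cand_def imp_cand_def and_cand_def or_cand_def all_cand_def ex_cand_def

lemma candidate_connectives:
  "candidate top_cand" "candidate (imp_cand a b)" "candidate (and_cand a b)"
  "candidate (or_cand a b)" "candidate (all_cand A)" "candidate (ex_cand A)"
  unfolding cand_defs by (rule candidate_val_cand; auto)+

lemma top_cand_eq: "top_cand = Collect SN"
  by (auto simp: top_cand_def val_cand_def)

section \<open>Introductions and eliminations respect the candidates\<close>

text \<open>Instantiating at a proof variable, which lies in \<open>a\<close>, makes a substitution
  instance of \<open>p\<close> strongly normalizing, hence \<open>p\<close> itself. Induction on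
  \<open>p\<close> then treats the reducts of \<open>Lam p\<close>; the hypothesis is inherited
  because reduction is stable under substitution.\<close>

lemma Lam_cand:
  assumes a: "candidate a" and b: "candidate b" and p: "\<And>q. q \<in> a \<Longrightarrow> psubst (pinst q) p \<in> b"
  shows "Lam p \<in> imp_cand a b"
proof -
  have "SN p"
    using candidate_SN[OF b p[OF candidate_PVar[OF a, of 0]]] by (rule SN_psubstD)
  then show ?thesis
    using p
  proof (induction p rule: SN_induct)
    case (1 p)
    have reds: "\<And>p' q. p \<rhd> p' \<Longrightarrow> q \<in> a \<Longrightarrow> psubst (pinst q) p' \<in> b"
      using 1(3) red_psubst candidate_red[OF b] by blast
    show ?case
      unfolding imp_cand_def
      by (rule val_cand_I) (use 1 reds in \<open>auto simp: imp_cand_def elim!: red_LamE\<close>)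
  qed
qed

text \<open>An application is neutral, so only its reducts matter. A contracted cut is handled by
  the condition on \<open>Lam\<close> in \<open>imp_cand\<close>, reductions in a component by
  induction. The other eliminations follow this pattern.\<close>

lemma App_cand:
  assumes a: "candidate a" and b: "candidate b" and p: "p \<in> imp_cand a b" and q: "q \<in> a"
  shows "App p q \<in> b"
  using candidate_SN[OF candidate_connectives(2) p] candidate_SN[OF a q] p q
proof (induction p q rule: SN_induct2)
  case (1 p q)
  show ?case
  proof (rule candidate_neutral[OF b])
    fix r assume "App p q \<rhd> r"
    then show "r \<in> b"
    proof (cases rule: red_AppE)
      case (beta p1)
      then show ?thesis
        using val_cand_D[OF \<open>p \<in> imp_cand a b\<close>[unfolded imp_cand_def]] \<open>q \<in> a\<close> by simp
    qed (use 1 candidate_red[OF a] candidate_red[OF candidate_connectives(2)] in blast)+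
  qed simp
qed

lemma Pair_cand:
  assumes a: "candidate a" and b: "candidate b" and p: "p \<in> a" and q: "q \<in> b"
  shows "Pair p q \<in> and_cand a b"
  using candidate_SN[OF a p] candidate_SN[OF b q] p q
proof (induction p q rule: SN_induct2)
  case (1 p q)
  show ?case
    unfolding and_cand_def
    by (rule val_cand_I)
      (use 1 in \<open>auto simp: and_cand_def elim!: red_PairE
        intro: candidate_red[OF a 1(5)] candidate_red[OF b 1(6)]\<close>)
qed

lemma Fst_cand:
  assumes a: "candidate a" and p: "p \<in> and_cand a b"
  shows "Fst p \<in> a"
  using candidate_SN[OF candidate_connectives(3) p] p
proof (induction p rule: SN_induct)
  case (1 p)
  show ?case
  proof (rule candidate_neutral[OF a])
    fix r assume "Fst p \<rhd> r"
    then show "r \<in> a"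
    proof (cases rule: red_FstE)
      case (beta q)
      then show ?thesis
        using val_cand_D[OF \<open>p \<in> and_cand a b\<close>[unfolded and_cand_def]] by simp
    qed (use 1 candidate_red[OF candidate_connectives(3)] in blast)
  qed simp
qed

lemma Snd_cand:
  assumes b: "candidate b" and p: "p \<in> and_cand a b"
  shows "Snd p \<in> b"
  using candidate_SN[OF candidate_connectives(3) p] p
proof (induction p rule: SN_induct)
  case (1 p)
  show ?case
  proof (rule candidate_neutral[OF b])
    fix r assume "Snd p \<rhd> r"
    then show "r \<in> b"
    proof (cases rule: red_SndE)
      case (beta q)
      then show ?thesis
        using val_cand_D[OF \<open>p \<in> and_cand a b\<close>[unfolded and_cand_def]] by simp
    qed (use 1 candidate_red[OF candidate_connectives(3)] in blast)
  qed simp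
qed

lemma InL_cand:
  assumes a: "candidate a" and p: "p \<in> a"
  shows "InL p \<in> or_cand a b"
  using candidate_SN[OF a p] p
proof (induction p rule: SN_induct)
  case (1 p)
  show ?case
    unfolding or_cand_def
    by (rule val_cand_I)
      (use 1 in \<open>auto simp: or_cand_def elim!: red_InLE
        intro: candidate_red[OF a 1(3)]\<close>)
qed

lemma InR_cand:
  assumes b: "candidate b" and p: "p \<in> b"
  shows "InR p \<in> or_cand a b"
  using candidate_SN[OF b p] p
proof (induction p rule: SN_induct)
  case (1 p)
  show ?case
    unfolding or_cand_def
    by (rule val_cand_I)
      (use 1 in \<open>auto simp: or_cand_def elim!: red_InRE
        intro: candidate_red[OF b 1(3)]\<close>)
qed

lemma Case_cand:
  assumes a: "candidate a" and b: "candidate b" and c: "candidate c" and p: "p \<in> or_cand a b"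
    and q: "\<And>u. u \<in> a \<Longrightarrow> psubst (pinst u) q \<in> c"
    and r: "\<And>u. u \<in> b \<Longrightarrow> psubst (pinst u) r \<in> c"
  shows "Case p q r \<in> c"
proof -
  have "SN p"
    using candidate_SN[OF candidate_connectives(4) p] .
  moreover have "SN q"
    using candidate_SN[OF c q[OF candidate_PVar[OF a, of 0]]] by (rule SN_psubstD)
  moreover have "SN r"
    using candidate_SN[OF c r[OF candidate_PVar[OF b, of 0]]] by (rule SN_psubstD)
  ultimately show ?thesis
    using p q r
  proof (induction p q r rule: SN_induct3)
    case (1 p q r)
    show ?case
    proof (rule candidate_neutral[OF c])
      fix v assume "Case p q r \<rhd> v"
      then show "v \<in> c"
      proof (cases rule: red_CaseE)
        case inl
        then show ?thesis
          using val_cand_D[OF \<open>p \<in> or_cand a b\<close>[unfolded or_cand_def]] 1 by simp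
      next
        case inr
        then show ?thesis
          using val_cand_D[OF \<open>p \<in> or_cand a b\<close>[unfolded or_cand_def]] 1 by simp
      next
        case (arg p')
        then show ?thesis
          using 1 candidate_red[OF candidate_connectives(4)] by blast
      next
        case (left q')
        then show ?thesis
          using 1 candidate_red[OF c] red_psubst by blast
      next
        case (right r')
        then show ?thesis
          using 1 candidate_red[OF c] red_psubst by blast
      qed
    qed simp
  qed
qed

text \<open>No cut-reduction contracts \<open>Abort\<close>, so every reduct comes from its
  argument. Hence strong normalization of the argument suffices, and falsity can denote
  \<open>top_cand\<close>.\<close>

lemma Abort_cand:
  assumes "candidate c" "SN p"
  shows "Abort p \<in> c"
  using assms(2)
proof (induction p rule: SN_induct)
  case (1 p)
  show ?case
    by (rule candidate_neutral[OF assms(1)]) (use 1 in \<open>auto elim: red_AbortE\<close>)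
qed

lemma Triv_cand: "Triv \<in> top_cand"
  unfolding top_cand_def by (rule val_cand_I) (auto elim: red_TrivE)

text \<open>Nonemptiness of \<open>A\<close> supplies a candidate containing an instance of
  \<open>p\<close>, from which \<open>p\<close> is strongly normalizing.\<close>

lemma TLam_cand:
  assumes A: "\<And>a. a \<in> A \<Longrightarrow> candidate a" and "A \<noteq> {}"
    and p: "\<And>t a. a \<in> A \<Longrightarrow> ptsubst (inst s t) p \<in> a"
  shows "TLam s p \<in> all_cand A"
proof -
  obtain a where "a \<in> A"
    using \<open>A \<noteq> {}\<close> by blast
  then have "SN p"
    using candidate_SN[OF A p] by (blast intro: SN_ptsubstD)
  then show ?thesis
    using p
  proof (induction p rule: SN_induct)
    case (1 p)
    have reds: "\<And>p' t a. p \<rhd> p' \<Longrightarrow> a \<in> A \<Longrightarrow> ptsubst (inst s t) p' \<in> a"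
      using 1(3) red_ptsubst candidate_red[OF A] by blast
    show ?case
      unfolding all_cand_def
      by (rule val_cand_I) (use 1 reds in \<open>auto simp: all_cand_def elim!: red_TLamE\<close>)
  qed
qed

lemma TApp_cand:
  assumes a: "candidate a" "a \<in> A" and p: "p \<in> all_cand A"
  shows "TApp p t \<in> a"
  using candidate_SN[OF candidate_connectives(5) p] p
proof (induction p rule: SN_induct)
  case (1 p)
  show ?case
  proof (rule candidate_neutral[OF a(1)])
    fix r assume "TApp p t \<rhd> r"
    then show "r \<in> a"
    proof (cases rule: red_TAppE)
      case beta
      then show ?thesis
        using val_cand_D[OF \<open>p \<in> all_cand A\<close>[unfolded all_cand_def]] \<open>a \<in> A\<close> by simp
    qed (use 1 candidate_red[OF candidate_connectives(5)] in blast)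
  qed simp
qed

lemma Pack_cand:
  assumes a: "candidate a" "a \<in> E" and p: "p \<in> a"
  shows "Pack t p \<in> ex_cand E"
  using candidate_SN[OF a(1) p] p
proof (induction p rule: SN_induct)
  case (1 p)
  show ?case
    unfolding ex_cand_def
    by (rule val_cand_I)
      (use 1 a(2) in \<open>auto simp: ex_cand_def elim!: red_PackE
        intro: candidate_red[OF a(1) 1(3)]\<close>)
qed

lemma Unpack_cand:
  assumes E: "\<And>a. a \<in> E \<Longrightarrow> candidate a" and "E \<noteq> {}" and c: "candidate c"
    and p: "p \<in> ex_cand E"
    and q: "\<And>t a u. a \<in> E \<Longrightarrow> u \<in> a \<Longrightarrow> psubst (pinst u) (ptsubst (inst s t) q) \<in> c"
  shows "Unpack s p q \<in> c"
proof -
  obtain a where "a \<in> E"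
    using \<open>E \<noteq> {}\<close> by blast
  then have "SN q"
    using candidate_SN[OF c q[OF _ candidate_PVar[OF E, of a 0]]]
    by (blast intro: SN_psubstD SN_ptsubstD)
  with candidate_SN[OF candidate_connectives(6) p] show ?thesis
    using p q
  proof (induction p q rule: SN_induct2)
    case (1 p q)
    show ?case
    proof (rule candidate_neutral[OF c])
      fix r assume "Unpack s p q \<rhd> r"
      then show "r \<in> c"
      proof (cases rule: red_UnpackE)
        case beta
        then show ?thesis
          using val_cand_D[OF \<open>p \<in> ex_cand E\<close>[unfolded ex_cand_def]] 1 by auto
      next
        case (arg p')
        then show ?thesis
          using 1 candidate_red[OF candidate_connectives(6)] by blast
      next
        case (branch q')
        then show ?thesis
          using 1 candidate_red[OF c] red_psubst red_ptsubst by blast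
      qed
    qed simp
  qed
qed

section \<open>The algebra of candidates\<close>

text \<open>Since every candidate counts as positive, the logical axioms reduce to closure of the
  carrier under the connectives.\<close>

definition cand_alg :: "('f, 's) pterm set ordered_tv_algebra" where
  "cand_alg = \<lparr>carr = Collect candidate, pos = Collect candidate,
    univs = Pow (Collect candidate), exs = Pow (Collect candidate),
    tv_top = top_cand, tv_bot = top_cand, tv_imp = imp_cand, tv_and = and_cand, tv_or = or_cand,
    tv_all = all_cand, tv_ex = ex_cand, tv_le = (\<subseteq>)\<rparr>"

lemma cand_alg_simps [simp]:
  "carr cand_alg = Collect candidate" "pos cand_alg = Collect candidate"
  "univs cand_alg = Pow (Collect candidate)" "exs cand_alg = Pow (Collect candidate)"
  "tv_top cand_alg = top_cand" "tv_bot cand_alg = top_cand" "tv_imp cand_alg = imp_cand"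
  "tv_and cand_alg = and_cand" "tv_or cand_alg = or_cand" "tv_all cand_alg = all_cand"
  "tv_ex cand_alg = ex_cand" "tv_le cand_alg = (\<subseteq>)"
  by (simp_all add: cand_alg_def)

lemma ordered_cand_alg:
  "ordered_truth_values_algebra (cand_alg :: ('f, 's) pterm set ordered_tv_algebra)"
proof
  fix a :: "('f, 's) pterm set"
  assume "a \<in> carr cand_alg" "tv_le cand_alg (tv_top cand_alg) a"
  then show "a = tv_top cand_alg"
    \<comment> \<open>\<open>top_cand\<close> consists of all strongly normalizing proof-terms, so
      it is the greatest candidate.\<close>
    unfolding cand_alg_simps top_cand_eq using candidate_SN by blast
next
  fix a a' b b' :: "('f, 's) pterm set"
  assume "tv_le cand_alg a a'" "tv_le cand_alg b b'"
  then show "tv_le cand_alg (tv_and cand_alg a b) (tv_and cand_alg a' b')"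
    "tv_le cand_alg (tv_or cand_alg a b) (tv_or cand_alg a' b')"
    unfolding cand_alg_simps and_cand_def or_cand_def by (auto intro!: val_cand_mono)
next
  fix a a' b b' :: "('f, 's) pterm set"
  assume "tv_le cand_alg a' a" "tv_le cand_alg b b'"
  then show "tv_le cand_alg (tv_imp cand_alg a b) (tv_imp cand_alg a' b')"
    by (auto simp: imp_cand_def intro!: val_cand_mono)
next
  fix A A' :: "('f, 's) pterm set set"
  assume "\<forall>y \<in> A'. \<exists>x \<in> A. tv_le cand_alg x y"
  then show "tv_le cand_alg (tv_all cand_alg A) (tv_all cand_alg A')"
    by (auto simp: all_cand_def intro!: val_cand_mono) blast
next
  fix A A' :: "('f, 's) pterm set set"
  assume "\<forall>x \<in> A. \<exists>y \<in> A'. tv_le cand_alg x y"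
  then show "tv_le cand_alg (tv_ex cand_alg A) (tv_ex cand_alg A')"
    by (auto simp: ex_cand_def intro!: val_cand_mono) blast
qed (auto simp: candidate_connectives)

lemma full_cand_alg: "full_tva cand_alg"
  by (simp add: full_tva_def)

text \<open>Intersecting with the strongly normalizing proof-terms matters for the empty family,
  whose plain intersection is everything.\<close>

lemma candidate_Inter:
  assumes "\<And>a. a \<in> S \<Longrightarrow> candidate a"
  shows "candidate (Collect SN \<inter> \<Inter> S)"
  unfolding candidate_def
proof (intro conjI ballI allI impI)
  fix p assume "p \<in> Collect SN \<inter> \<Inter> S"
  then show "SN p" by simp
next
  fix p p' assume "p \<in> Collect SN \<inter> \<Inter> S" "p \<rhd> p'"
  then show "p' \<in> Collect SN \<inter> \<Inter> S"
    using SN_red candidate_red[OF assms] by blast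
next
  fix p assume "neutral p" "\<forall>p'. p \<rhd> p' \<longrightarrow> p' \<in> Collect SN \<inter> \<Inter> S"
  then show "p \<in> Collect SN \<inter> \<Inter> S"
    using SN_I[of p] candidate_neutral[OF assms, of _ p] by blast
qed

lemma complete_cand_alg: "complete_tva cand_alg"
  unfolding complete_tva_def
proof (intro allI impI)
  fix S :: "('f, 's) pterm set set" assume "S \<subseteq> carr cand_alg"
  then have "candidate (Collect SN \<inter> \<Inter> S)"
    by (intro candidate_Inter) auto
  then show "\<exists>g \<in> carr cand_alg. (\<forall>x \<in> S. tv_le cand_alg g x) \<and>
      (\<forall>h \<in> carr cand_alg. (\<forall>x \<in> S. tv_le cand_alg h x) \<longrightarrow> tv_le cand_alg h g)"
    by (intro bexI[of _ "Collect SN \<inter> \<Inter> S"]) (auto intro: candidate_SN)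
qed

section \<open>Denotations\<close>

lemma tden_tsubst: "tden M \<phi> (tsubst \<sigma> t) = tden M (\<lambda>s n. tden M \<phi> (\<sigma> s n)) t"
  by (induction t) (auto intro!: arg_cong2[where f="fint M"])

lemma tden_extend_shift: "(\<lambda>s' n. tden M (extend s e \<phi>) (shift s s' n)) = \<phi>"
  by (intro ext) (simp add: shift_def extend_def)

lemma tden_extend_up:
  "(\<lambda>s' n. tden M (extend s e \<phi>) (up s \<sigma> s' n)) = extend s e (\<lambda>s' n. tden M \<phi> (\<sigma> s' n))"
  by (intro ext)
    (auto simp: up_def tden_tsubst tden_extend_shift extend_def[of _ _ "\<lambda>s' n. tden M \<phi> (\<sigma> s' n)"]
      split: nat.split, simp add: extend_def)

lemma fden_fsubst: "fden B M \<phi> (fsubst \<sigma> A) = fden B M (\<lambda>s n. tden M \<phi> (\<sigma> s n)) A"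
  by (induction A arbitrary: \<phi> \<sigma>)
    (auto simp: tden_extend_up tden_tsubst intro!: arg_cong2[where f="pint M"])

lemma fden_shift: "fden B M (extend s e \<phi>) (fsubst (shift s) A) = fden B M \<phi> A"
  by (simp add: fden_fsubst tden_extend_shift)

lemma fden_inst: "fden B M \<phi> (fsubst (inst s t) A) = fden B M (extend s (tden M \<phi> t) \<phi>) A"
proof -
  have "(\<lambda>s' n. tden M \<phi> (inst s t s' n)) = extend s (tden M \<phi> t) \<phi>"
    by (intro ext) (auto simp: inst_def extend_def split: nat.split)
  then show ?thesis
    by (simp add: fden_fsubst)
qed

lemma is_assignment_extend: "is_assignment M \<phi> \<Longrightarrow> e \<in> dom M s \<Longrightarrow> is_assignment M (extend s e \<phi>)"
  by (auto simp: is_assignment_def extend_def split: nat.split)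

lemma map_in_listset: "(\<And>t. t \<in> set ts \<Longrightarrow> f t \<in> D (g t)) \<Longrightarrow> map f ts \<in> listset (map D (map g ts))"
  by (induction ts) (auto simp: set_Cons_def)

lemma tden_in_dom:
  assumes "is_structure B \<Sigma> M" "is_assignment M \<phi>"
  shows "wf_tm \<Sigma> t \<Longrightarrow> tden M \<phi> t \<in> dom M (sort_of \<Sigma> t)"
proof (induction t)
  case (Var s n)
  then show ?case using assms(2) by (simp add: is_assignment_def)
next
  case (Fn f ts)
  then have "map (tden M \<phi>) ts \<in> listset (map (dom M) (map (sort_of \<Sigma>) ts))"
    by (intro map_in_listset) auto
  then show ?case
    \<comment> \<open>Fusing the two maps would hide \<open>map (sort_of \<Sigma>) ts\<close>, which
      well-sortedness equates with \<open>fargs \<Sigma> f\<close>.\<close>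
    using Fn.prems assms(1) by (simp add: is_structure_def del: map_map)
qed

text \<open>Only atoms depend on the structure; all other formulae denote a value of some
  connective, which is a candidate by \<open>candidate_connectives\<close>.\<close>

lemma candidate_fden:
  assumes "is_structure cand_alg \<Sigma> M"
  shows "is_assignment M \<phi> \<Longrightarrow> wf_fm \<Sigma> A \<Longrightarrow> candidate (fden cand_alg M \<phi> A)"
proof (induction A arbitrary: \<phi>)
  case (Atom P ts)
  then have "map (tden M \<phi>) ts \<in> listset (map (dom M) (map (sort_of \<Sigma>) ts))"
    by (intro map_in_listset tden_in_dom[OF assms]) auto
  then show ?case
    using Atom.prems assms by (simp add: is_structure_def del: map_map)
qed (simp_all add: candidate_connectives)

section \<open>Adequacy\<close>

lemma nd_wf: "nd T \<Gamma> p A \<Longrightarrow> wf_fm (sig T) A"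
  by (induction rule: nd.induct) (auto simp: fcong_def)

lemma fcong_wf: "fcong T A C \<Longrightarrow> wf_fm (sig T) A" "fcong T A C \<Longrightarrow> wf_fm (sig T) C"
  by (simp_all add: fcong_def)

text \<open>Induction on the derivation, with all three environments general: proof binders extend
  \<open>\<theta>\<close>, while a term binder extends \<open>\<sigma>\<close> by a term and
  \<open>\<phi>\<close> by an independently chosen element of the domain.\<close>

lemma adequacy:
  assumes "is_model cand_alg T M" "nd T \<Gamma> p A" "is_assignment M \<phi>"
    and "\<And>i. i < length \<Gamma> \<Longrightarrow> \<theta> i \<in> fden cand_alg M \<phi> (\<Gamma> ! i)"
  shows "psubst \<theta> (ptsubst \<sigma> p) \<in> fden cand_alg M \<phi> A"
proof -
  have M: "is_structure cand_alg (sig T) M"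
    using assms(1) by (simp add: is_model_def)
  have cong: "fden cand_alg M \<phi> A = fden cand_alg M \<phi> C" if "is_assignment M \<phi>" "fcong T A C" for \<phi> A C
    using assms(1) that unfolding is_model_def by blast
  note cand = candidate_fden[OF M]
  have dom: "dom M s \<noteq> {}" for s
    using M by (simp add: is_structure_def)
  have Cons: "case_nat q \<theta> i \<in> fden cand_alg M \<phi> ((A # \<Gamma>) ! i)"
    if "q \<in> fden cand_alg M \<phi> A" "\<And>i. i < length \<Gamma> \<Longrightarrow> \<theta> i \<in> fden cand_alg M \<phi> (\<Gamma> ! i)"
      "i < length (A # \<Gamma>)" for q \<theta> A \<Gamma> i \<phi>
    using that by (cases i) auto
  show ?thesis
    using assms(2-)
  proof (induction arbitrary: \<phi> \<theta> \<sigma> rule: nd.induct)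
    case (Hyp i \<Gamma> A)
    then show ?case using cong[of \<phi> "\<Gamma> ! i" A] Hyp(4)[OF Hyp(1)] by simp
  next
    case (TopI A \<Gamma>)
    then show ?case using cong[of \<phi> A Top] by (simp add: Triv_cand)
  next
    case (BotE \<Gamma> p B A)
    then have "psubst \<theta> (ptsubst \<sigma> p) \<in> top_cand"
      using cong[of \<phi> B Bot] by auto
    then show ?case
      using BotE cand by (simp add: Abort_cand top_cand_eq)
  next
    case (ImpI A \<Gamma> p B C)
    have wf: "wf_fm (sig T) A" "wf_fm (sig T) B"
      using fcong_wf(2)[OF ImpI(2)] by auto
    have "psubst (pinst q) (psubst (upp \<theta>) (ptsubst \<sigma> p)) \<in> fden cand_alg M \<phi> B"
      if "q \<in> fden cand_alg M \<phi> A" for q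
      unfolding psubst_pinst_upp by (rule ImpI.IH) (use ImpI.prems that Cons in auto)
    then show ?case
      using cong[OF ImpI.prems(1) ImpI(2)] wf ImpI.prems(1) by (simp add: Lam_cand cand)
  next
    case (ImpE \<Gamma> p C q A B)
    have wf: "wf_fm (sig T) A" "wf_fm (sig T) B"
      using fcong_wf(2)[OF ImpE(3)] by auto
    have "psubst \<theta> (ptsubst \<sigma> p) \<in> imp_cand (fden cand_alg M \<phi> A) (fden cand_alg M \<phi> B)"
      using ImpE.IH(1)[OF ImpE.prems] ImpE.prems(1) cong[OF ImpE.prems(1) ImpE(3)] by simp
    then show ?case
      using App_cand[OF cand[OF ImpE.prems(1) wf(1)] cand[OF ImpE.prems(1) wf(2)]]
        ImpE.IH(2)[OF ImpE.prems] ImpE.prems(1) by simp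
  next
    case (AndI \<Gamma> p A q B C)
    have wf: "wf_fm (sig T) A" "wf_fm (sig T) B"
      using fcong_wf(2)[OF AndI(3)] by auto
    then show ?case
      using AndI.IH[OF AndI.prems] AndI.prems(1) cong[OF AndI.prems(1) AndI(3)] by (simp add: Pair_cand cand)
  next
    case (AndE1 \<Gamma> p C A B)
    have wf: "wf_fm (sig T) A"
      using fcong_wf(2)[OF AndE1(2)] by auto
    have "psubst \<theta> (ptsubst \<sigma> p) \<in> and_cand (fden cand_alg M \<phi> A) (fden cand_alg M \<phi> B)"
      using AndE1.IH[OF AndE1.prems] AndE1.prems(1) cong[OF AndE1.prems(1) AndE1(2)] by simp
    then show ?case
      using Fst_cand[OF cand[OF AndE1.prems(1) wf]] by simp
  next
    case (AndE2 \<Gamma> p C A B)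
    have wf: "wf_fm (sig T) B"
      using fcong_wf(2)[OF AndE2(2)] by auto
    have "psubst \<theta> (ptsubst \<sigma> p) \<in> and_cand (fden cand_alg M \<phi> A) (fden cand_alg M \<phi> B)"
      using AndE2.IH[OF AndE2.prems] AndE2.prems(1) cong[OF AndE2.prems(1) AndE2(2)] by simp
    then show ?case
      using Snd_cand[OF cand[OF AndE2.prems(1) wf]] by simp
  next
    case (OrI1 \<Gamma> p A C B)
    have "wf_fm (sig T) A"
      using fcong_wf(2)[OF OrI1(2)] by auto
    then show ?case
      using OrI1.IH[OF OrI1.prems] OrI1.prems(1) cong[OF OrI1.prems(1) OrI1(2)] by (simp add: InL_cand cand)
  next
    case (OrI2 \<Gamma> p B C A)
    have "wf_fm (sig T) B"
      using fcong_wf(2)[OF OrI2(2)] by auto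
    then show ?case
      using OrI2.IH[OF OrI2.prems] OrI2.prems(1) cong[OF OrI2.prems(1) OrI2(2)] by (simp add: InR_cand cand)
  next
    case (OrE \<Gamma> p D A q C B r)
    note asg = OrE.prems(1)
    have wf: "wf_fm (sig T) A" "wf_fm (sig T) B" "wf_fm (sig T) C"
      using fcong_wf(2)[OF OrE(4)] nd_wf[OF OrE(2)] by auto
    have p: "psubst \<theta> (ptsubst \<sigma> p) \<in> or_cand (fden cand_alg M \<phi> A) (fden cand_alg M \<phi> B)"
      using OrE.IH(1)[OF OrE.prems] OrE.prems(1) cong[OF asg OrE(4)] by simp
    have q: "psubst (pinst u) (psubst (upp \<theta>) (ptsubst \<sigma> q)) \<in> fden cand_alg M \<phi> C"
      if "u \<in> fden cand_alg M \<phi> A" for u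
      unfolding psubst_pinst_upp by (rule OrE.IH(2)) (use OrE.prems that Cons in auto)
    have r: "psubst (pinst u) (psubst (upp \<theta>) (ptsubst \<sigma> r)) \<in> fden cand_alg M \<phi> C"
      if "u \<in> fden cand_alg M \<phi> B" for u
      unfolding psubst_pinst_upp by (rule OrE.IH(3)) (use OrE.prems that Cons in auto)
    show ?case
      using Case_cand[OF cand[OF asg wf(1)] cand[OF asg wf(2)] cand[OF asg wf(3)] p q r] by simp
  next
    case (AllI s \<Gamma> p A C)
    note asg = is_assignment_extend[OF AllI.prems(1)]
    have wf: "wf_fm (sig T) A"
      using fcong_wf(2)[OF AllI(2)] by auto
    have "ptsubst (inst s t) (psubst (upt s \<theta>) (ptsubst (up s \<sigma>) p)) \<in>
        fden cand_alg M (extend s e \<phi>) A" if "e \<in> dom M s" for t e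
      \<comment> \<open>Going below the binder and instantiating it merge into one term
        substitution, at which the induction hypothesis is taken. By \<open>fden_shift\<close> the
        shifted hypotheses keep their denotations.\<close>
      unfolding ptsubst_inst_upt ptsubst_ptsubst
      by (rule AllI.IH) (use AllI.prems that asg in \<open>auto simp: fden_shift\<close>)
    then have "TLam s (psubst (upt s \<theta>) (ptsubst (up s \<sigma>) p)) \<in>
        all_cand ((\<lambda>e. fden cand_alg M (extend s e \<phi>) A) ` dom M s)"
      by (intro TLam_cand) (use asg wf dom cand in auto)
    then show ?case
      using cong[OF AllI.prems(1) AllI(2)] by simp
  next
    case (AllE \<Gamma> p D s A t C)
    note asg = AllE.prems(1)
    have e: "tden M \<phi> t \<in> dom M s"
      using tden_in_dom[OF M asg AllE(3)] AllE(4) by simp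
    have wf: "wf_fm (sig T) A"
      using fcong_wf(2)[OF AllE(2)] by auto
    have "psubst \<theta> (ptsubst \<sigma> p) \<in> all_cand ((\<lambda>e. fden cand_alg M (extend s e \<phi>) A) ` dom M s)"
      using AllE.IH[OF AllE.prems] AllE.prems(1) cong[OF asg AllE(2)] by simp
    \<comment> \<open>The applied term is \<open>tsubst \<sigma> t\<close>, but the candidate is
      chosen through \<open>tden M \<phi> t\<close>; \<open>all_cand\<close> admits any such
      pair.\<close>
    then have "TApp (psubst \<theta> (ptsubst \<sigma> p)) (tsubst \<sigma> t) \<in>
        fden cand_alg M (extend s (tden M \<phi> t) \<phi>) A"
      by (intro TApp_cand) (use e wf cand is_assignment_extend[OF asg] in auto)
    then show ?case
      using cong[OF asg AllE(5)] by (simp add: fden_inst)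
  next
    case (ExI \<Gamma> p D t s A C)
    note asg = ExI.prems(1)
    have e: "tden M \<phi> t \<in> dom M s"
      using tden_in_dom[OF M asg ExI(2)] ExI(3) by simp
    have wf: "wf_fm (sig T) A"
      using fcong_wf(2)[OF ExI(5)] by auto
    have p: "psubst \<theta> (ptsubst \<sigma> p) \<in> fden cand_alg M (extend s (tden M \<phi> t) \<phi>) A"
      using ExI.IH[OF ExI.prems] cong[OF asg ExI(4)] by (simp add: fden_inst)
    have "Pack (tsubst \<sigma> t) (psubst \<theta> (ptsubst \<sigma> p)) \<in>
        ex_cand ((\<lambda>e. fden cand_alg M (extend s e \<phi>) A) ` dom M s)"
      by (rule Pack_cand[OF _ _ p]) (use e wf cand is_assignment_extend[OF asg] in auto)
    then show ?case
      using cong[OF asg ExI(5)] by simp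
  next
    case (ExE \<Gamma> p D s A q B)
    note asg = is_assignment_extend[OF ExE.prems(1)]
    have wf: "wf_fm (sig T) A"
      using fcong_wf(2)[OF ExE(2)] by auto
    have p: "psubst \<theta> (ptsubst \<sigma> p) \<in> ex_cand ((\<lambda>e. fden cand_alg M (extend s e \<phi>) A) ` dom M s)"
      using ExE.IH(1)[OF ExE.prems] cong[OF ExE.prems(1) ExE(2)] by simp
    have q: "psubst (pinst u) (ptsubst (inst s t) (psubst (upp (upt s \<theta>)) (ptsubst (up s \<sigma>) q)))
        \<in> fden cand_alg M \<phi> B"
      if e: "e \<in> dom M s" and u: "u \<in> fden cand_alg M (extend s e \<phi>) A" for t e u
    proof -
      \<comment> \<open>Here both kinds of environment grow at once; the shifted conclusion denotes
        the same candidate as \<open>B\<close> under \<open>\<phi>\<close>.\<close>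
      have "psubst (case_nat u \<theta>) (ptsubst (\<lambda>s' n. tsubst (inst s t) (up s \<sigma> s' n)) q)
          \<in> fden cand_alg M (extend s e \<phi>) (fsubst (shift s) B)"
        by (rule ExE.IH(2)[OF asg[OF e]])
          (rule Cons[OF u], use ExE.prems in \<open>auto simp: fden_shift\<close>)
      then show ?thesis
        by (simp add: fden_shift ptsubst_inst_upp_upt ptsubst_ptsubst psubst_pinst_upp)
    qed
    have "Unpack s (psubst \<theta> (ptsubst \<sigma> p)) (psubst (upp (upt s \<theta>)) (ptsubst (up s \<sigma>) q))
        \<in> fden cand_alg M \<phi> B"
      by (rule Unpack_cand[OF _ _ _ p]) (use q asg wf dom cand ExE.prems(1) ExE(4) in auto)
    then show ?case
      by simp
  qed
qed

theorem mainTheorem1: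
  fixes T :: "('f, 'p, 's) dm_theory" and \<pi> :: "('f, 's) pterm" and A :: "('f, 'p, 's) fm"
  assumes "wf_dm_theory T"
    and "super_consistent TYPE(('f, 's) pterm set) TYPE('m) T"
    and "is_proof T \<pi> A"
  shows "strongly_normalizing \<pi>"
proof -
  obtain M :: "('f, 'p, 's, 'm, ('f, 's) pterm set) struct" where M: "is_model cand_alg T M"
    using assms(2) ordered_cand_alg full_cand_alg complete_cand_alg
    unfolding super_consistent_def by blast
  then have struct: "is_structure cand_alg (sig T) M"
    by (simp add: is_model_def)
  \<comment> \<open>Any assignment will do; one exists because the domains are nonempty.\<close>
  define \<phi> where "\<phi> s n = (SOME e. e \<in> dom M s)" for s and n :: nat
  have \<phi>: "is_assignment M \<phi>"
    using struct by (auto simp: is_structure_def is_assignment_def \<phi>_def some_in_eq)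
  obtain \<Gamma> where \<Gamma>: "set \<Gamma> \<subseteq> axs T" "nd T \<Gamma> \<pi> A"
    using assms(3) by (auto simp: is_proof_def)
  have "wf_fm (sig T) (\<Gamma> ! i)" if "i < length \<Gamma>" for i
    using assms(1) \<Gamma>(1) nth_mem[OF that] unfolding wf_dm_theory_def by blast
  \<comment> \<open>With identity substitutions the hypotheses only have to contain their own proof
    variables, as all candidates do.\<close>
  then have "psubst PVar (ptsubst Var \<pi>) \<in> fden cand_alg M \<phi> A"
    by (intro adequacy[OF M \<Gamma>(2) \<phi>] candidate_PVar candidate_fden[OF struct \<phi>])
  then show ?thesis
    using candidate_SN[OF candidate_fden[OF struct \<phi> nd_wf[OF \<Gamma>(2)]]] by simp
qed

end
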